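(* There exist generic frontals $f_1,f_2:\Sigma\to\mathbb{R}^3$ such that $f_1$ is isometric to $f_2$, but $f_1$ is not $\mathcal{A}$-equivalent to $f_2$ at a singular point $p\in\Sigma$.
   Context: All manifolds and maps are $C^\infty$. Let $\Sigma$ be an oriented smooth $2$-manifold and $f:\Sigma\to\mathbb{R}^3$ a smooth map. A point where $f$ is not an immersion is a singular point; $S(f)$ is the set of singular points. $f$ is a surface if $\Sigma\setminus S(f)$ is dense. A surface $f$ is a frontal if each point has an open neighborhood $D$ with a smooth map $\nu:D\to S^2$ (unit normal vector field) such that $df_q(v)\cdot\nu(q)=0$ for all $q\in D$, $v\in T_q\Sigma$. A singular point $p$ is of rank one if $\operatorname{rank}(df_p)=1$; at such a point, choosing an orientation-compatible coordinate system $(u,v)$ with $f_u(p)=0$, the limiting normal curvature is $\kappa_\nu(p)=\dfrac{f_{vv}(p)\cdot\nu(p)}{\|f_v(p)\|^2}$ (independent of the choice of such coordinates). A frontal $f$ is generic if $S(f)$ is non-empty, every singular point is of rank one, and $\kappa_\nu$ does not vanish on $S(f)$. $f_1$ and $f_2$ are isometric if their first fundamental forms (pullbacks of the Euclidean metric) coincide; in particular $S(f_1)=S(f_2)$. They are $\mathcal{A}$-equivalent at $p$ if there are diffeomorphism-germs $\varphi:(\Sigma,p)\to(\Sigma,p)$ and $\Phi:(\mathbb{R}^3,f_1(p))\to(\mathbb{R}^3,f_2(p))$ with $f_2=\Phi\circ f_1\circ\varphi^{-1}$ as germs. *)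

theory Defs
  imports "HOL-Analysis.Analysis"
begin

section \<open>Smooth maps between Euclidean spaces\<close>

text \<open>On an open set of a Euclidean space, \<open>Ck_on k\<close> is the usual notion of class \<open>C^k\<close>: all iterated
  directional derivatives up to order \<open>k\<close> exist (as Frechet derivatives up to order \<open>k\<close>) and are
  continuous. It is only used on open sets.\<close>

primrec Ck_on :: "nat \<Rightarrow> 'a::euclidean_space set \<Rightarrow> ('a \<Rightarrow> 'b::real_normed_vector) \<Rightarrow> bool" where
  "Ck_on 0 S f \<longleftrightarrow> continuous_on S f"
| "Ck_on (Suc k) S f \<longleftrightarrow>
     (\<forall>x\<in>S. f differentiable (at x)) \<and> (\<forall>v. Ck_on k S (\<lambda>x. frechet_derivative f (at x) v))"

definition smooth_on :: "'a::euclidean_space set \<Rightarrow> ('a \<Rightarrow> 'b::real_normed_vector) \<Rightarrow> bool" where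
  "smooth_on S f \<longleftrightarrow> (\<forall>k. Ck_on k S f)"

section \<open>Oriented smooth 2-manifolds\<close>

text \<open>A manifold is an abstract topology \<open>X\<close> with an oriented smooth atlas \<open>A\<close>. A chart is a pair of its
  domain and its coordinate map; values of the coordinate map outside the domain are irrelevant.
  The topology is not tied to any topology of the type \<open>'a\<close>: since a second countable manifold has at most
  continuum many points, every such manifold can be carried by a subset of, for example, the type
  \<open>real^2\<close>.\<close>

type_synonym 'a chart = "'a set \<times> ('a \<Rightarrow> real^2)"

definition chart_image :: "'a chart \<Rightarrow> 'a set \<Rightarrow> (real^2) set" where
  "chart_image c D = snd c ` (fst c \<inter> D)"

definition chart_inv :: "'a chart \<Rightarrow> real^2 \<Rightarrow> 'a" where
  "chart_inv c = inv_into (fst c) (snd c)"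

definition is_chart :: "'a topology \<Rightarrow> 'a chart \<Rightarrow> bool" where
  "is_chart X c \<longleftrightarrow> openin X (fst c) \<and> open (snd c ` fst c) \<and>
     homeomorphic_map (subtopology X (fst c)) (top_of_set (snd c ` fst c)) (snd c)"

definition oriented_transition :: "'a chart \<Rightarrow> 'a chart \<Rightarrow> bool" where
  "oriented_transition c d \<longleftrightarrow>
     smooth_on (chart_image c (fst d)) (snd d \<circ> chart_inv c) \<and>
     (\<forall>x\<in>chart_image c (fst d). det (matrix (frechet_derivative (snd d \<circ> chart_inv c) (at x))) > 0)"

definition oriented_surface :: "'a topology \<Rightarrow> 'a chart set \<Rightarrow> bool" where
  "oriented_surface X A \<longleftrightarrow>
     Hausdorff_space X \<and> second_countable X \<and>
     (\<forall>c\<in>A. is_chart X c) \<and> topspace X = (\<Union>c\<in>A. fst c) \<and>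
     (\<forall>c\<in>A. \<forall>d\<in>A. oriented_transition c d)"

text \<open>The coordinate systems compatible with the smooth structure and the orientation, i.e. the members
  of the maximal oriented atlas containing \<open>A\<close>.\<close>

definition coordinate_system :: "'a topology \<Rightarrow> 'a chart set \<Rightarrow> 'a chart \<Rightarrow> bool" where
  "coordinate_system X A c \<longleftrightarrow>
     is_chart X c \<and> (\<forall>d\<in>A. oriented_transition c d \<and> oriented_transition d c)"

definition smooth_map_on :: "'a chart set \<Rightarrow> 'a set \<Rightarrow> ('a \<Rightarrow> 'b::real_normed_vector) \<Rightarrow> bool" where
  "smooth_map_on A D g \<longleftrightarrow> (\<forall>c\<in>A. smooth_on (chart_image c D) (g \<circ> chart_inv c))"

text \<open>Smoothness of a map from \<open>D\<close> to the manifold itself; continuity (which makes the sets below open)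
  is required separately where this is used.\<close>

definition smooth_self_map_on :: "'a chart set \<Rightarrow> 'a set \<Rightarrow> ('a \<Rightarrow> 'a) \<Rightarrow> bool" where
  "smooth_self_map_on A D g \<longleftrightarrow>
     (\<forall>c\<in>A. \<forall>d\<in>A. smooth_on (chart_image c (D \<inter> g -` fst d)) (snd d \<circ> g \<circ> chart_inv c))"

section \<open>Singular points, frontals, limiting normal curvature\<close>

text \<open>The differential \<open>df_p\<close>, with tangent vectors at \<open>p\<close> expressed by their components in the
  coordinate system \<open>c\<close>.\<close>

definition differential :: "'a chart \<Rightarrow> ('a \<Rightarrow> real^3) \<Rightarrow> 'a \<Rightarrow> real^2 \<Rightarrow> real^3" where
  "differential c f p = frechet_derivative (f \<circ> chart_inv c) (at (snd c p))"

definition immersion_at :: "'a chart set \<Rightarrow> ('a \<Rightarrow> real^3) \<Rightarrow> 'a \<Rightarrow> bool" where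
  "immersion_at A f p \<longleftrightarrow> (\<forall>c\<in>A. p \<in> fst c \<longrightarrow> inj (differential c f p))"

definition singular_set :: "'a topology \<Rightarrow> 'a chart set \<Rightarrow> ('a \<Rightarrow> real^3) \<Rightarrow> 'a set" where
  "singular_set X A f = {p \<in> topspace X. \<not> immersion_at A f p}"

definition rank_one_at :: "'a chart set \<Rightarrow> ('a \<Rightarrow> real^3) \<Rightarrow> 'a \<Rightarrow> bool" where
  "rank_one_at A f p \<longleftrightarrow> (\<forall>c\<in>A. p \<in> fst c \<longrightarrow> dim (range (differential c f p)) = 1)"

definition is_surface :: "'a topology \<Rightarrow> 'a chart set \<Rightarrow> ('a \<Rightarrow> real^3) \<Rightarrow> bool" where
  "is_surface X A f \<longleftrightarrow> smooth_map_on A (topspace X) f \<and>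
     X closure_of (topspace X - singular_set X A f) = topspace X"

definition unit_normal_on :: "'a chart set \<Rightarrow> ('a \<Rightarrow> real^3) \<Rightarrow> 'a set \<Rightarrow> ('a \<Rightarrow> real^3) \<Rightarrow> bool" where
  "unit_normal_on A f D \<nu> \<longleftrightarrow> smooth_map_on A D \<nu> \<and> (\<forall>q\<in>D. norm (\<nu> q) = 1) \<and>
     (\<forall>c\<in>A. \<forall>q\<in>D \<inter> fst c. \<forall>v. differential c f q v \<bullet> \<nu> q = 0)"

definition frontal :: "'a topology \<Rightarrow> 'a chart set \<Rightarrow> ('a \<Rightarrow> real^3) \<Rightarrow> bool" where
  "frontal X A f \<longleftrightarrow> is_surface X A f \<and>
     (\<forall>p\<in>topspace X. \<exists>D \<nu>. openin X D \<and> p \<in> D \<and> unit_normal_on A f D \<nu>)"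

text \<open>Partial derivatives with respect to the coordinates \<open>(u, v)\<close> of \<open>c\<close>.\<close>

definition deriv_u :: "'a chart \<Rightarrow> ('a \<Rightarrow> real^3) \<Rightarrow> 'a \<Rightarrow> real^3" where
  "deriv_u c f p = differential c f p (axis 1 1)"

definition deriv_v :: "'a chart \<Rightarrow> ('a \<Rightarrow> real^3) \<Rightarrow> 'a \<Rightarrow> real^3" where
  "deriv_v c f p = differential c f p (axis 2 1)"

definition adapted_at ::
    "'a topology \<Rightarrow> 'a chart set \<Rightarrow> ('a \<Rightarrow> real^3) \<Rightarrow> 'a \<Rightarrow> 'a chart \<Rightarrow> bool" where
  "adapted_at X A f p c \<longleftrightarrow> coordinate_system X A c \<and> p \<in> fst c \<and> deriv_u c f p = 0"

text \<open>At a rank one singular point adapted coordinate systems exist and the value does not depend on the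
  chosen one; it depends on \<open>\<nu>\<close> only through the sign of \<open>\<nu> p\<close>.\<close>

definition limiting_normal_curvature ::
    "'a topology \<Rightarrow> 'a chart set \<Rightarrow> ('a \<Rightarrow> real^3) \<Rightarrow> ('a \<Rightarrow> real^3) \<Rightarrow> 'a \<Rightarrow> real" where
  "limiting_normal_curvature X A f \<nu> p =
     (let c = (SOME c. adapted_at X A f p c)
      in (deriv_v c (deriv_v c f) p \<bullet> \<nu> p) / (norm (deriv_v c f p))\<^sup>2)"

definition generic_frontal :: "'a topology \<Rightarrow> 'a chart set \<Rightarrow> ('a \<Rightarrow> real^3) \<Rightarrow> bool" where
  "generic_frontal X A f \<longleftrightarrow> frontal X A f \<and> singular_set X A f \<noteq> {} \<and>
     (\<forall>p\<in>singular_set X A f. rank_one_at A f p \<and>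
        (\<forall>D \<nu>. openin X D \<and> p \<in> D \<and> unit_normal_on A f D \<nu> \<longrightarrow>
           limiting_normal_curvature X A f \<nu> p \<noteq> 0))"

section \<open>Isometry and A-equivalence\<close>

definition first_fundamental_form ::
    "'a chart \<Rightarrow> ('a \<Rightarrow> real^3) \<Rightarrow> 'a \<Rightarrow> real^2 \<Rightarrow> real^2 \<Rightarrow> real" where
  "first_fundamental_form c f p v w = differential c f p v \<bullet> differential c f p w"

definition isometric :: "'a chart set \<Rightarrow> ('a \<Rightarrow> real^3) \<Rightarrow> ('a \<Rightarrow> real^3) \<Rightarrow> bool" where
  "isometric A f1 f2 \<longleftrightarrow>
     (\<forall>c\<in>A. \<forall>p\<in>fst c. first_fundamental_form c f1 p = first_fundamental_form c f2 p)"

text \<open>A diffeomorphism germ is represented by a diffeomorphism between open neighbourhoods, given together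
  with its inverse. Diffeomorphism germs need not preserve orientation.\<close>

definition source_diffeo_germ ::
    "'a topology \<Rightarrow> 'a chart set \<Rightarrow> 'a \<Rightarrow> 'a set \<Rightarrow> 'a set \<Rightarrow> ('a \<Rightarrow> 'a) \<Rightarrow> ('a \<Rightarrow> 'a) \<Rightarrow> bool" where
  "source_diffeo_germ X A p V W \<phi> \<phi>' \<longleftrightarrow>
     openin X V \<and> openin X W \<and> p \<in> V \<and> \<phi> p = p \<and>
     homeomorphic_maps (subtopology X V) (subtopology X W) \<phi> \<phi>' \<and>
     smooth_self_map_on A V \<phi> \<and> smooth_self_map_on A W \<phi>'"

definition target_diffeo_germ ::
    "real^3 \<Rightarrow> real^3 \<Rightarrow> (real^3) set \<Rightarrow> (real^3) set \<Rightarrow> (real^3 \<Rightarrow> real^3) \<Rightarrow> (real^3 \<Rightarrow> real^3) \<Rightarrow> bool"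
  where
  "target_diffeo_germ x y V W \<Phi> \<Phi>' \<longleftrightarrow>
     open V \<and> open W \<and> x \<in> V \<and> \<Phi> x = y \<and>
     homeomorphism V W \<Phi> \<Phi>' \<and> smooth_on V \<Phi> \<and> smooth_on W \<Phi>'"

definition A_equivalent_at ::
    "'a topology \<Rightarrow> 'a chart set \<Rightarrow> ('a \<Rightarrow> real^3) \<Rightarrow> ('a \<Rightarrow> real^3) \<Rightarrow> 'a \<Rightarrow> bool" where
  "A_equivalent_at X A f1 f2 p \<longleftrightarrow>
     (\<exists>V W \<phi> \<phi>' V' W' \<Phi> \<Phi>' N.
        source_diffeo_germ X A p V W \<phi> \<phi>' \<and>
        target_diffeo_germ (f1 p) (f2 p) V' W' \<Phi> \<Phi>' \<and>
        openin X N \<and> p \<in> N \<and> N \<subseteq> W \<and>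
        (\<forall>q\<in>N. f1 (\<phi>' q) \<in> V' \<and> f2 q = \<Phi> (f1 (\<phi>' q))))"

end

theory Submission
  imports Defs
begin

text \<open>
  Both frontals are translation surfaces over the plane,
    \<open>f(u, v) = (x(u), y(v), c u\<^sup>2 / 2 + w(v))\<close> with \<open>x'(u) = u X(u)\<close>,
  the sum of a singular profile curve \<open>(x, 0, c u\<^sup>2 / 2)\<close> and a regular directrix \<open>(0, y, w)\<close>. The velocity
  of the profile is \<open>u\<close> times the nowhere vanishing vector \<open>(X, 0, c)\<close>, so \<open>f\<close> is singular exactly
  on the line \<open>u = 0\<close>, of rank one there, and the cross product of \<open>(X, 0, c)\<close> with the velocity of the
  directrix extends the normal direction over that line. The limiting normal curvature is nonzero as soon
  as the acceleration of the directrix leaves the limiting tangent plane. This is the lemma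
  \<open>generic_frontal_f\<close>.

  The first fundamental form of \<open>f\<close> involves only \<open>X\<^sup>2 + c\<^sup>2\<close>, \<open>c w'\<close> and \<open>y'\<^sup>2 + w'\<^sup>2\<close>. Hence
  the heights of the two curves can be rescaled by reciprocal factors, the horizontal parts absorbing the
  change of length. The choices \<open>c = 3\<close>, \<open>(y, w) = (4 v, 5 cosh v)\<close> and \<open>c = 5\<close>,
  \<open>(y, w) = (4 sinh v, 3 cosh v)\<close> give isometric surfaces when \<open>X = 4 sqrt (1 + Y\<^sup>2)\<close> for the first and
  \<open>X = 4 Y\<close> for the second, with \<open>Y\<close> any common smooth function.

  Since \<open>y\<close> is injective in both cases and the height is even in \<open>u\<close>, the double points of the surfaces are
  the pairs \<open>(\<plusminus>u, v)\<close> with \<open>x(u) = x(-u)\<close>. Take \<open>Y(t) = exp (- t\<^sup>2) + \<psi>(t)\<close>, where \<open>t \<psi>(t)\<close> is the derivative of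
  a function \<open>F \<ge> 0\<close> that vanishes for \<open>t \<le> 0\<close> and at a sequence of positive points tending to 0, but is
  positive at other points arbitrarily close to 0. For the second surface \<open>x(u) - x(-u) = 4 F(u)\<close> for \<open>u > 0\<close>,
  so there are double points arbitrarily close to the origin. For the first surface, convexity of
  \<open>sqrt (1 + r\<^sup>2)\<close> bounds \<open>x(u) - x(-u)\<close> from below by 4 times the integral of \<open>F' m\<close> over \<open>[0, u]\<close>, where the
  weight \<open>m\<close> is positive and strictly decreasing on the positive axis. That integral is \<open>F(u) m(u)\<close> minus the
  integral of \<open>F m'\<close>, which is positive (lemma \<open>partner_profile_asymmetric\<close>), so the first surface is
  globally injective. As A-equivalence at a point preserves local injectivity, the two frontals are not
  A-equivalent at the origin.
\<close>

section \<open>Calculus of smooth functions\<close>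

lemma Ck_on_cong:
  assumes "open S" "\<And>x. x \<in> S \<Longrightarrow> f x = g x"
  shows "Ck_on k S f \<longleftrightarrow> Ck_on k S g"
  using assms(2)
proof (induction k arbitrary: f g)
  case 0
  then show ?case by (auto intro: continuous_on_cong)
next
  case (Suc k)
  have iff: "(f has_derivative D) (at x) \<longleftrightarrow> (g has_derivative D) (at x)" if "x \<in> S" for x D
    using has_derivative_transform_within_open[OF _ \<open>open S\<close> that] Suc.prems by metis
  then have "frechet_derivative f (at x) = frechet_derivative g (at x)" if "x \<in> S" for x
    using that by (simp add: frechet_derivative_def)
  then have "Ck_on k S (\<lambda>x. frechet_derivative f (at x) v) \<longleftrightarrow>
      Ck_on k S (\<lambda>x. frechet_derivative g (at x) v)" for v
    by (intro Suc.IH) simp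
  moreover have "f differentiable (at x) \<longleftrightarrow> g differentiable (at x)" if "x \<in> S" for x
    using iff[OF that] by (simp add: differentiable_def)
  ultimately show ?case by simp
qed

text \<open>Replaces the choice operator inside \<open>frechet_derivative\<close> by an explicit derivative; all
  closure properties below go through this rule, by induction on the order of differentiability.\<close>
lemma Ck_on_SucI:
  assumes "open S" "\<And>x. x \<in> S \<Longrightarrow> (f has_derivative f' x) (at x)"
    and "\<And>v. Ck_on k S (\<lambda>x. f' x v)"
  shows "Ck_on (Suc k) S f"
proof -
  have "frechet_derivative f (at x) = f' x" if "x \<in> S" for x
    using frechet_derivative_at[OF assms(2)[OF that]] by simp
  then have "Ck_on k S (\<lambda>x. frechet_derivative f (at x) v) \<longleftrightarrow> Ck_on k S (\<lambda>x. f' x v)" for v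
    by (intro Ck_on_cong[OF \<open>open S\<close>]) simp
  with assms show ?thesis by (auto simp: differentiable_def)
qed

lemma Ck_on_SucD:
  assumes "Ck_on (Suc k) S f"
  shows "x \<in> S \<Longrightarrow> (f has_derivative frechet_derivative f (at x)) (at x)"
    and "Ck_on k S (\<lambda>x. frechet_derivative f (at x) v)"
  using assms by (auto simp: frechet_derivative_works)

lemma Ck_on_Suc_imp: "Ck_on (Suc k) S f \<Longrightarrow> Ck_on k S f"
proof (induction k arbitrary: f)
  case 0
  then show ?case
    by (auto intro!: continuous_at_imp_continuous_on differentiable_imp_continuous_within)
next
  case (Suc k)
  have "Ck_on k S (\<lambda>x. frechet_derivative f (at x) v)" for v
    by (rule Suc.IH[OF Ck_on_SucD(2)[OF Suc.prems]])
  then show ?case using Suc.prems by simp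
qed

lemma Ck_on_add:
  assumes "open S" "Ck_on k S f" "Ck_on k S g"
  shows "Ck_on k S (\<lambda>x. f x + g x)"
  using assms(2,3)
proof (induction k arbitrary: f g)
  case 0
  then show ?case by (simp add: continuous_on_add continuous_on_scaleR)
next
  case (Suc k)
  note f = Ck_on_SucD[OF Suc.prems(1)] and g = Ck_on_SucD[OF Suc.prems(2)]
  show ?case
    by (rule Ck_on_SucI[OF \<open>open S\<close> has_derivative_add[OF f(1) g(1)] Suc.IH[OF f(2) g(2)]])
qed

lemma Ck_on_scaleR:
  fixes a :: "'a::euclidean_space \<Rightarrow> real"
  assumes "open S" "Ck_on k S a" "Ck_on k S f"
  shows "Ck_on k S (\<lambda>x. a x *\<^sub>R f x)"
  using assms(2,3)
proof (induction k arbitrary: a f)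
  case 0
  then show ?case by (simp add: continuous_on_add continuous_on_scaleR)
next
  case (Suc k)
  note a = Ck_on_SucD[OF Suc.prems(1)] and f = Ck_on_SucD[OF Suc.prems(2)]
  note low = Suc.prems[THEN Ck_on_Suc_imp]
  show ?case
    by (rule Ck_on_SucI[OF \<open>open S\<close> has_derivative_scaleR[OF a(1) f(1)]
          Ck_on_add[OF \<open>open S\<close> Suc.IH[OF low(1) f(2)] Suc.IH[OF a(2) low(2)]]])
qed

lemma Ck_on_compose:
  fixes f :: "'a::euclidean_space \<Rightarrow> real" and g :: "real \<Rightarrow> real"
  assumes "open S" "open T" "f ` S \<subseteq> T" "Ck_on k S f" "Ck_on k T g"
  shows "Ck_on k S (\<lambda>x. g (f x))"
  using assms(4,5)
proof (induction k arbitrary: g)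
  case 0
  then show ?case
    using assms(3) continuous_on_compose2[of T g S f] by simp
next
  case (Suc k)
  have "((\<lambda>x. g (f x)) has_derivative
      (\<lambda>v. frechet_derivative f (at x) v *\<^sub>R frechet_derivative g (at (f x)) 1)) (at x)"
    if "x \<in> S" for x
  proof -
    have "f x \<in> T" using that assms(3) by blast
    from has_derivative_compose[OF Ck_on_SucD(1)[OF Suc.prems(1) that] Ck_on_SucD(1)[OF Suc.prems(2) this]]
    have "((\<lambda>x. g (f x)) has_derivative
        (\<lambda>v. frechet_derivative g (at (f x)) (frechet_derivative f (at x) v))) (at x)" .
    moreover have "frechet_derivative g (at (f x)) r = r *\<^sub>R frechet_derivative g (at (f x)) 1" for r
      using linear_scale[OF has_derivative_linear[OF Ck_on_SucD(1)[OF Suc.prems(2) \<open>f x \<in> T\<close>]], of r 1] by simp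
    then have "(\<lambda>v. frechet_derivative g (at (f x)) (frechet_derivative f (at x) v)) =
        (\<lambda>v. frechet_derivative f (at x) v *\<^sub>R frechet_derivative g (at (f x)) 1)"
      by (rule ext)
    ultimately show ?thesis by (simp only:)
  qed
  from Ck_on_SucI[OF \<open>open S\<close> this Ck_on_scaleR[OF \<open>open S\<close> Ck_on_SucD(2)[OF Suc.prems(1)]
        Suc.IH[OF Ck_on_Suc_imp[OF Suc.prems(1)] Ck_on_SucD(2)[OF Suc.prems(2)]]]]
  show ?case .
qed

text \<open>The smooth functions form the largest class of differentiable functions closed under directional derivatives, so
  it suffices to exhibit one such class containing \<open>f\<close>. This avoids computing iterated derivatives.\<close>
lemma smooth_on_coinduct:
  assumes "open S" "Q f"
    and step: "\<And>f. Q f \<Longrightarrow> \<exists>f'. (\<forall>x\<in>S. (f has_derivative f' x) (at x)) \<and> (\<forall>v. Q (\<lambda>x. f' x v))"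
  shows "smooth_on S f"
proof -
  have "Ck_on k S f" for k
    using \<open>Q f\<close>
  proof (induction k arbitrary: f)
    case 0
    from step[OF this] obtain f' where f': "\<forall>x\<in>S. (f has_derivative f' x) (at x)" by blast
    have "continuous_on S f"
      by (rule continuous_at_imp_continuous_on) (use f' has_derivative_continuous in blast)
    then show ?case by simp
  next
    case (Suc k)
    from step[OF Suc.prems] obtain f'
      where f': "\<forall>x\<in>S. (f has_derivative f' x) (at x)" "\<forall>v. Q (\<lambda>x. f' x v)" by (elim exE conjE)
    have "Ck_on k S (\<lambda>x. f' x v)" for v
      by (rule Suc.IH) (rule f'(2)[THEN spec])
    with f'(1) show ?case
      by (intro Ck_on_SucI[where f' = f', OF \<open>open S\<close>]) simp_all
  qed
  then show ?thesis by (simp add: smooth_on_def)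
qed

lemma smooth_on_Ck_on: "smooth_on S f \<Longrightarrow> Ck_on k S f"
  by (simp add: smooth_on_def)

lemma smooth_on_has_derivative:
  "smooth_on S f \<Longrightarrow> x \<in> S \<Longrightarrow> (f has_derivative frechet_derivative f (at x)) (at x)"
  by (rule Ck_on_SucD(1)[OF smooth_on_Ck_on])

lemma smooth_on_frechet_derivative:
  assumes "smooth_on S f"
  shows "smooth_on S (\<lambda>x. frechet_derivative f (at x) v)"
  unfolding smooth_on_def by (intro allI Ck_on_SucD(2)[OF smooth_on_Ck_on[OF assms]])

lemma smooth_on_continuous: "smooth_on S f \<Longrightarrow> continuous_on S f"
  using smooth_on_Ck_on[of S f 0] by simp

lemma smooth_on_const:
  assumes "open S"
  shows "smooth_on S (\<lambda>_. c)"
proof (rule smooth_on_coinduct[where Q = "\<lambda>f. \<exists>c. f = (\<lambda>_. c)", OF assms])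
  fix f :: "'a \<Rightarrow> 'b" assume "\<exists>c. f = (\<lambda>_. c)"
  then have "\<forall>x\<in>S. (f has_derivative (\<lambda>_. 0)) (at x)" by auto
  then show "\<exists>f'. (\<forall>x\<in>S. (f has_derivative f' x) (at x)) \<and> (\<forall>v. \<exists>c. (\<lambda>x. f' x v) = (\<lambda>_. c))"
    by (intro exI[of _ "\<lambda>_ _. 0"]) blast
qed blast

lemma smooth_on_linear:
  assumes "open S" "bounded_linear L"
  shows "smooth_on S L"
proof -
  have "Ck_on k S L" for k
  proof (cases k)
    case 0
    then show ?thesis using assms(2) by (simp add: linear_continuous_on)
  next
    case (Suc j)
    have "Ck_on j S (\<lambda>_. L v)" for v
      using smooth_on_const[OF assms(1)] by (auto simp: smooth_on_def)
    then have "Ck_on (Suc j) S L"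
      by (intro Ck_on_SucI[where f' = "\<lambda>_. L", OF assms(1) bounded_linear_imp_has_derivative[OF assms(2)]])
    with Suc show ?thesis by simp
  qed
  then show ?thesis by (simp add: smooth_on_def)
qed

lemma smooth_on_add:
  assumes "open S" "smooth_on S f" "smooth_on S g"
  shows "smooth_on S (\<lambda>x. f x + g x)"
  unfolding smooth_on_def
  by (intro allI Ck_on_add[OF assms(1)] assms(2,3)[unfolded smooth_on_def, THEN spec])

lemma smooth_on_scaleR:
  assumes "open S" "smooth_on S a" "smooth_on S f"
  shows "smooth_on S (\<lambda>x. a x *\<^sub>R f x)"
  unfolding smooth_on_def
  by (intro allI Ck_on_scaleR[OF assms(1)] assms(2,3)[unfolded smooth_on_def, THEN spec])

lemma smooth_on_mult:
  fixes a b :: "'a::euclidean_space \<Rightarrow> real"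
  assumes "open S" "smooth_on S a" "smooth_on S b"
  shows "smooth_on S (\<lambda>x. a x * b x)"
  using smooth_on_scaleR[OF assms] by simp

lemma smooth_on_compose:
  fixes f :: "'a::euclidean_space \<Rightarrow> real" and g :: "real \<Rightarrow> real"
  assumes "open S" "open T" "f ` S \<subseteq> T" "smooth_on S f" "smooth_on T g"
  shows "smooth_on S (\<lambda>x. g (f x))"
proof -
  have "Ck_on k S (\<lambda>x. g (f x))" for k
    by (rule Ck_on_compose[OF assms(1-3) smooth_on_Ck_on[OF assms(4)] smooth_on_Ck_on[OF assms(5)]])
  then show ?thesis by (simp add: smooth_on_def)
qed

lemma smooth_on_antiderivative:
  fixes g :: "real \<Rightarrow> real"
  assumes "open S" "\<And>t. t \<in> S \<Longrightarrow> (g has_real_derivative g' t) (at t)" "smooth_on S g'"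
  shows "smooth_on S g"
proof -
  have "Ck_on (Suc k) S g" for k
  proof (rule Ck_on_SucI[OF assms(1)])
    show "(g has_derivative (*) (g' t)) (at t)" if "t \<in> S" for t
      using assms(2)[OF that] by (simp add: has_field_derivative_def)
    show "Ck_on k S (\<lambda>t. g' t * v)" for v
      using smooth_on_mult[OF assms(1,3) smooth_on_const[OF assms(1)]] by (simp add: smooth_on_def)
  qed
  then have "Ck_on k S g" for k by (rule Ck_on_Suc_imp)
  then show ?thesis by (simp add: smooth_on_def)
qed

lemma smooth_on_real_coinduct:
  fixes f :: "real \<Rightarrow> real"
  assumes "open S" "Q f"
    and step: "\<And>f. Q f \<Longrightarrow> \<exists>f'. Q f' \<and> (\<forall>t\<in>S. (f has_real_derivative f' t) (at t))"
    and scale: "\<And>f c. Q f \<Longrightarrow> Q (\<lambda>t. f t * c)"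
  shows "smooth_on S f"
proof (rule smooth_on_coinduct[where Q = Q, OF \<open>open S\<close> \<open>Q f\<close>])
  fix f assume "Q f"
  from step[OF this] obtain f' where f': "Q f'" "\<forall>t\<in>S. (f has_real_derivative f' t) (at t)"
    by (elim exE conjE)
  have "Q (\<lambda>t. f' t * v)" for v by (rule scale[OF f'(1)])
  with f'(2) show "\<exists>f'. (\<forall>t\<in>S. (f has_derivative f' t) (at t)) \<and> (\<forall>v. Q (\<lambda>t. f' t v))"
    by (intro exI[of _ "\<lambda>t. (*) (f' t)"]) (simp add: has_field_derivative_def)
qed

text \<open>Real powers cover both the square root in the profile and the reciprocal square root that
  normalises the normal field.\<close>
lemma smooth_on_powr: "smooth_on {0<..} (\<lambda>s::real. s powr a)"
proof -
  let ?Q = "\<lambda>f. \<exists>a b. \<forall>s::real\<in>{0<..}. f s = b * s powr a"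
  have Q: "?Q (\<lambda>s. b * s powr a)" for a b :: real by blast
  show ?thesis
  proof (rule smooth_on_real_coinduct[where Q = ?Q])
    show "?Q (\<lambda>s. s powr a)" using Q[of 1 a] by simp
  next
    fix f :: "real \<Rightarrow> real" assume "?Q f"
    then obtain a b where f: "\<And>s. s \<in> {0<..} \<Longrightarrow> f s = b * s powr a" by blast
    have "(f has_real_derivative (b * a) * s powr (a - 1)) (at s)" if "s \<in> {0<..}" for s
    proof (rule has_field_derivative_transform_within_open[OF _ open_greaterThan that])
      show "((\<lambda>s. b * s powr a) has_real_derivative (b * a) * s powr (a - 1)) (at s)"
        using that by (auto intro!: derivative_eq_intros)
      show "b * r powr a = f r" if "r \<in> {0<..}" for r
        using f[OF that] by simp
    qed
    then show "\<exists>f'. ?Q f' \<and> (\<forall>t\<in>{0<..}. (f has_real_derivative f' t) (at t))"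
      by (intro exI[of _ "\<lambda>s. (b * a) * s powr (a - 1)"] conjI Q ballI)
  next
    fix f :: "real \<Rightarrow> real" and c assume "?Q f"
    then obtain a b where "\<And>s. s \<in> {0<..} \<Longrightarrow> f s = b * s powr a" by blast
    then have "\<forall>s\<in>{0<..}. f s * c = (b * c) * s powr a" by simp
    then show "?Q (\<lambda>t. f t * c)" by blast
  qed simp
qed

lemma smooth_on_sinh_cosh:
  "smooth_on UNIV (\<lambda>s::real. a * sinh s + b * cosh s)"
proof -
  let ?Q = "\<lambda>f. \<exists>a b. \<forall>s::real. f s = a * sinh s + b * cosh s"
  have Q: "?Q (\<lambda>s. a * sinh s + b * cosh s)" for a b by blast
  show ?thesis
  proof (rule smooth_on_real_coinduct[where Q = ?Q])
    show "?Q (\<lambda>s. a * sinh s + b * cosh s)" by (rule Q)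
  next
    fix f :: "real \<Rightarrow> real" assume "?Q f"
    then obtain a b where f: "f = (\<lambda>s. a * sinh s + b * cosh s)" by (elim exE) (blast intro: ext)
    have "(f has_real_derivative b * sinh t + a * cosh t) (at t)" for t
      unfolding f by (rule derivative_eq_intros refl)+ simp
    then show "\<exists>f'. ?Q f' \<and> (\<forall>t\<in>UNIV. (f has_real_derivative f' t) (at t))"
      by (intro exI[of _ "\<lambda>t. b * sinh t + a * cosh t"] conjI Q ballI)
  next
    fix f :: "real \<Rightarrow> real" and c assume "?Q f"
    then obtain a b where "\<And>s. f s = a * sinh s + b * cosh s" by blast
    then have "\<forall>s. f s * c = (a * c) * sinh s + (b * c) * cosh s" by (simp add: algebra_simps)
    then show "?Q (\<lambda>t. f t * c)" by blast
  qed simp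
qed

lemma smooth_on_exp: "smooth_on UNIV (exp :: real \<Rightarrow> real)"
  using smooth_on_sinh_cosh[of 1 1] by (simp add: sinh_plus_cosh)

lemma ex_antiderivative:
  fixes g :: "real \<Rightarrow> real"
  assumes "continuous_on UNIV g"
  shows "\<exists>G. \<forall>t. (G has_real_derivative g t) (at t)"
  using einterval_antiderivative[of "-\<infinity>" "\<infinity>" g] assms
  by (simp add: continuous_on_eq_continuous_at has_real_derivative_iff_has_vector_derivative)

section \<open>Flat oscillating functions\<close>

text \<open>Polynomials in \<open>s\<close>, \<open>cos s\<close> and \<open>sin s\<close> that are at most linear in the trigonometric part: a class of
  polynomially growing functions closed under differentiation and under multiplication by \<open>s\<close>.\<close>
inductive_set quasi_poly :: "(real \<Rightarrow> real) set" where
  monomial: "(\<lambda>s. s ^ n) \<in> quasi_poly"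
| cos: "(\<lambda>s. s ^ n * cos s) \<in> quasi_poly"
| sin: "(\<lambda>s. s ^ n * sin s) \<in> quasi_poly"
| add: "\<theta> \<in> quasi_poly \<Longrightarrow> \<eta> \<in> quasi_poly \<Longrightarrow> (\<lambda>s. \<theta> s + \<eta> s) \<in> quasi_poly"
| scale: "\<theta> \<in> quasi_poly \<Longrightarrow> (\<lambda>s. c * \<theta> s) \<in> quasi_poly"

lemma quasi_poly_times_id: "\<theta> \<in> quasi_poly \<Longrightarrow> (\<lambda>s. s * \<theta> s) \<in> quasi_poly"
proof (induction rule: quasi_poly.induct)
  case (monomial n)
  show ?case using quasi_poly.monomial[of "Suc n"] by (simp only: power_Suc)
next
  case (cos n)
  show ?case using quasi_poly.cos[of "Suc n"] by (simp only: power_Suc mult.assoc)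
next
  case (sin n)
  show ?case using quasi_poly.sin[of "Suc n"] by (simp only: power_Suc mult.assoc)
next
  case (add \<theta> \<eta>)
  show ?case using quasi_poly.add[OF add.IH] by (simp only: distrib_left)
next
  case (scale \<theta> c)
  show ?case using quasi_poly.scale[OF scale.IH, of c] by (simp only: mult.left_commute[of c])
qed

lemma quasi_poly_deriv:
  "\<theta> \<in> quasi_poly \<Longrightarrow> \<exists>\<theta>'\<in>quasi_poly. \<forall>s. (\<theta> has_real_derivative \<theta>' s) (at s)"
proof (induction rule: quasi_poly.induct)
  case (monomial n)
  show ?case
    by (rule bexI[OF _ quasi_poly.scale[OF quasi_poly.monomial, of "real n" "n - 1"]])
      (auto intro!: derivative_eq_intros)
next
  case (cos n)
  show ?case
    by (rule bexI[OF _ quasi_poly.add[OF quasi_poly.scale[OF quasi_poly.cos, of "real n" "n - 1"]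
            quasi_poly.scale[OF quasi_poly.sin, of "-1" n]]])
      (auto intro!: derivative_eq_intros)
next
  case (sin n)
  show ?case
    by (rule bexI[OF _ quasi_poly.add[OF quasi_poly.scale[OF quasi_poly.sin, of "real n" "n - 1"]
            quasi_poly.cos[of n]]])
      (auto intro!: derivative_eq_intros)
next
  case (add \<theta> \<eta>)
  then obtain \<theta>' \<eta>' where "\<theta>' \<in> quasi_poly" "\<eta>' \<in> quasi_poly"
    "\<forall>s. (\<theta> has_real_derivative \<theta>' s) (at s)" "\<forall>s. (\<eta> has_real_derivative \<eta>' s) (at s)" by blast
  then show ?case
    by (intro bexI[OF _ quasi_poly.add[of \<theta>' \<eta>']]) (auto intro: DERIV_add)
next
  case (scale \<theta> c)
  then obtain \<theta>' where "\<theta>' \<in> quasi_poly" "\<forall>s. (\<theta> has_real_derivative \<theta>' s) (at s)" by blast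
  then show ?case
    by (intro bexI[OF _ quasi_poly.scale[of \<theta>' c]]) (auto intro: DERIV_cmult)
qed

lemma quasi_poly_growth: "\<theta> \<in> quasi_poly \<Longrightarrow> \<exists>C. \<forall>s>0. \<bar>exp (- s) * \<theta> s\<bar> * s\<^sup>2 \<le> C"
proof (induction rule: quasi_poly.induct)
  have mono: "exp (- s) * s ^ n * s\<^sup>2 \<le> fact (n + 2)" if "s > 0" for s :: real and n
  proof -
    have "s ^ (n + 2) / fact (n + 2) \<le> exp s"
      using that sum_le_suminf[of "\<lambda>k. s ^ k /\<^sub>R fact k" "{n + 2}"] summable_exp_generic[of s]
      by (auto simp: exp_def divide_inverse mult.commute)
    then have "s ^ (n + 2) \<le> exp s * fact (n + 2)"
      by (simp only: pos_divide_le_eq[OF fact_gt_zero])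
    then have "exp (- s) * s ^ (n + 2) \<le> exp (- s) * (exp s * fact (n + 2))"
      by (intro mult_left_mono) auto
    also have "\<dots> = fact (n + 2)" by (simp add: exp_minus del: fact_Suc)
    finally show ?thesis by (simp only: power_add mult.assoc)
  qed
  have osc: "\<bar>exp (- s) * (s ^ n * r)\<bar> * s\<^sup>2 \<le> fact (n + 2)" if "s > 0" "\<bar>r\<bar> \<le> 1" for s r :: real and n
  proof -
    have "\<bar>exp (- s) * (s ^ n * r)\<bar> * s\<^sup>2 = (exp (- s) * s ^ n * s\<^sup>2) * \<bar>r\<bar>"
      using that by (simp add: abs_mult)
    also have "\<dots> \<le> exp (- s) * s ^ n * s\<^sup>2"
      using that by (intro mult_left_le) auto
    finally show ?thesis using mono[OF that(1), of n] by linarith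
  qed
  {
    case (monomial n)
    show ?case using osc[of _ 1 n] by auto
  next
    case (cos n)
    show ?case using osc[of _ "cos _" n] by (metis abs_cos_le_one)
  next
    case (sin n)
    show ?case using osc[of _ "sin _" n] by (metis abs_sin_le_one)
  next
    case (add \<theta> \<eta>)
    then obtain C D where CD: "\<forall>s>0. \<bar>exp (- s) * \<theta> s\<bar> * s\<^sup>2 \<le> C" "\<forall>s>0. \<bar>exp (- s) * \<eta> s\<bar> * s\<^sup>2 \<le> D"
      by blast
    have "\<bar>exp (- s) * (\<theta> s + \<eta> s)\<bar> * s\<^sup>2 \<le> C + D" if "s > 0" for s
    proof -
      have "\<bar>exp (- s) * (\<theta> s + \<eta> s)\<bar> * s\<^sup>2 \<le> (\<bar>exp (- s) * \<theta> s\<bar> + \<bar>exp (- s) * \<eta> s\<bar>) * s\<^sup>2"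
        by (intro mult_right_mono) (auto simp: distrib_left)
      also have "\<dots> \<le> C + D" using CD that by (simp add: distrib_right add_mono)
      finally show ?thesis .
    qed
    then show ?case by blast
  next
    case (scale \<theta> c)
    then obtain C where C: "\<forall>s>0. \<bar>exp (- s) * \<theta> s\<bar> * s\<^sup>2 \<le> C" by blast
    have "\<bar>exp (- s) * (c * \<theta> s)\<bar> * s\<^sup>2 \<le> \<bar>c\<bar> * C" if "s > 0" for s
    proof -
      have "\<bar>exp (- s) * (c * \<theta> s)\<bar> * s\<^sup>2 = \<bar>c\<bar> * (\<bar>exp (- s) * \<theta> s\<bar> * s\<^sup>2)"
        by (simp add: abs_mult)
      also have "\<dots> \<le> \<bar>c\<bar> * C" using C that by (intro mult_left_mono) auto
      finally show ?thesis .
    qed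
    then show ?case by blast
  }
qed

text \<open>The value 0 on the negative axis and the exponential decay at \<open>0\<close> from the right make this function
  flat at \<open>0\<close> whenever \<open>\<theta>\<close> grows polynomially.\<close>
definition flat_function :: "(real \<Rightarrow> real) \<Rightarrow> real \<Rightarrow> real" where
  "flat_function \<theta> t = (if t \<le> 0 then 0 else exp (- (1 / t)) * \<theta> (1 / t))"

text \<open>With \<open>s = 1 / t\<close> we have \<open>ds / dt = - s\<^sup>2\<close>, which produces the formula away from \<open>0\<close>; at \<open>0\<close> the function
  is \<open>O(t\<^sup>2)\<close>. The operator taking \<open>\<theta>\<close> to \<open>s\<^sup>2 (\<theta> - \<theta>')\<close> preserves quasi-polynomials, so flat functions are smooth.\<close>
lemma flat_function_deriv:
  assumes "\<theta> \<in> quasi_poly" and d: "\<And>s. (\<theta> has_real_derivative \<theta>' s) (at s)"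
  shows "(flat_function \<theta> has_real_derivative flat_function (\<lambda>s. s * (s * (\<theta> s - \<theta>' s))) t) (at t)"
proof -
  consider "t < 0" | "t > 0" | "t = 0" by linarith
  then show ?thesis
  proof cases
    case 1
    have "((\<lambda>_. 0) has_real_derivative 0) (at t)" by simp
    then have "(flat_function \<theta> has_real_derivative 0) (at t)"
      by (rule DERIV_cong_ev[THEN iffD1, rotated -1])
        (use 1 eventually_nhds_in_open[of "{..<0}" t] in \<open>auto elim!: eventually_mono simp: flat_function_def\<close>)
    then show ?thesis using 1 by (simp add: flat_function_def)
  next
    case 2
    have "((\<lambda>t. exp (- (1 / t)) * \<theta> (1 / t)) has_real_derivative
        exp (- (1 / t)) * ((1 / t) * ((1 / t) * (\<theta> (1 / t) - \<theta>' (1 / t))))) (at t)"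
      using 2 by (auto intro!: derivative_eq_intros DERIV_chain2[OF d] simp: field_simps)
    then have "(flat_function \<theta> has_real_derivative
        exp (- (1 / t)) * ((1 / t) * ((1 / t) * (\<theta> (1 / t) - \<theta>' (1 / t))))) (at t)"
      by (rule DERIV_cong_ev[THEN iffD1, rotated -1])
        (use 2 eventually_nhds_in_open[of "{0<..}" t] in \<open>auto elim!: eventually_mono simp: flat_function_def\<close>)
    then show ?thesis using 2 by (simp add: flat_function_def)
  next
    case 3
    obtain C where C: "\<And>s. s > 0 \<Longrightarrow> \<bar>exp (- s) * \<theta> s\<bar> * s\<^sup>2 \<le> C"
      using quasi_poly_growth[OF assms(1)] by blast
    have bound: "\<bar>flat_function \<theta> h\<bar> / \<bar>h\<bar> \<le> \<bar>C\<bar> * \<bar>h\<bar>" for h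
    proof (cases "h > 0")
      case True
      then have "\<bar>exp (- (1 / h)) * \<theta> (1 / h)\<bar> * (1 / h)\<^sup>2 \<le> \<bar>C\<bar>"
        using C[of "1 / h"] by simp
      then have "\<bar>exp (- (1 / h)) * \<theta> (1 / h)\<bar> \<le> \<bar>C\<bar> * h\<^sup>2"
        using True by (simp only: power_one_over) (simp add: pos_divide_le_eq)
      with True show ?thesis
        by (simp add: flat_function_def pos_divide_le_eq power2_eq_square mult.assoc)
    qed (auto simp: flat_function_def mult_nonneg_nonpos)
    have "((\<lambda>h. flat_function \<theta> h / h) \<longlongrightarrow> 0) (at 0)"
    proof (rule Lim_null_comparison)
      show "\<forall>\<^sub>F h in at 0. norm (flat_function \<theta> h / h) \<le> \<bar>C\<bar> * \<bar>h\<bar>" using bound by simp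
      show "((\<lambda>h. \<bar>C\<bar> * \<bar>h\<bar>) \<longlongrightarrow> 0) (at 0)" by (auto intro!: tendsto_eq_intros)
    qed
    then show ?thesis using 3 by (simp add: DERIV_def flat_function_def)
  qed
qed

lemma smooth_on_flat_function:
  assumes "\<theta> \<in> quasi_poly"
  shows "smooth_on UNIV (flat_function \<theta>)"
proof (rule smooth_on_real_coinduct[where Q = "\<lambda>f. \<exists>\<theta>\<in>quasi_poly. f = flat_function \<theta>"])
  fix f assume "\<exists>\<theta>\<in>quasi_poly. f = flat_function \<theta>"
  then obtain \<theta> where \<theta>: "\<theta> \<in> quasi_poly" "f = flat_function \<theta>" by blast
  obtain \<theta>' where \<theta>': "\<theta>' \<in> quasi_poly" "\<And>s. (\<theta> has_real_derivative \<theta>' s) (at s)"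
    using quasi_poly_deriv[OF \<theta>(1)] by blast
  have "(\<lambda>s. \<theta> s - \<theta>' s) \<in> quasi_poly"
    using quasi_poly.add[OF \<theta>(1) quasi_poly.scale[OF \<theta>'(1), of "-1"]] by simp
  then have "(\<lambda>s. s * (s * (\<theta> s - \<theta>' s))) \<in> quasi_poly"
    by (intro quasi_poly_times_id)
  then show "\<exists>f'. (\<exists>\<theta>\<in>quasi_poly. f' = flat_function \<theta>) \<and> (\<forall>t\<in>UNIV. (f has_real_derivative f' t) (at t))"
    using flat_function_deriv[OF \<theta>(1) \<theta>'(2)] \<theta>(2) by blast
next
  fix f c assume "\<exists>\<theta>\<in>quasi_poly. f = flat_function \<theta>"
  then obtain \<theta> where \<theta>: "\<theta> \<in> quasi_poly" "f = flat_function \<theta>" by blast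
  then have "(\<lambda>t. f t * c) = flat_function (\<lambda>s. c * \<theta> s)" by (auto simp: flat_function_def)
  then show "\<exists>\<theta>\<in>quasi_poly. (\<lambda>t. f t * c) = flat_function \<theta>"
    using quasi_poly.scale[OF \<theta>(1), of c] by blast
qed (use assms in auto)

section \<open>The plane as an oriented surface\<close>

abbreviation standard_atlas :: "(real^2) chart set" where
  "standard_atlas \<equiv> {(UNIV, id)}"

lemma chart_inv_id [simp]: "chart_inv (UNIV, id) = id"
  by (simp add: chart_inv_def)

lemma chart_image_id [simp]: "chart_image (UNIV, id) D = D"
  by (simp add: chart_image_def)

lemma differential_id [simp]: "differential (UNIV, id) f p = frechet_derivative f (at p)"
  by (simp add: differential_def)

lemma is_chart_id: "is_chart euclidean (UNIV, id)"
  by (simp add: is_chart_def)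

lemma oriented_transition_id: "oriented_transition (UNIV, id) (UNIV, id :: real^2 \<Rightarrow> real^2)"
  using smooth_on_linear[OF open_UNIV bounded_linear_ident]
  by (simp add: oriented_transition_def matrix_id_mat_1 id_def[symmetric])

lemma oriented_surface_plane: "oriented_surface euclidean standard_atlas"
proof -
  have "second_countable (euclidean :: (real^2) topology)"
  proof -
    obtain \<B> :: "(real^2) set set" where "countable \<B>" "topological_basis \<B>"
      using ex_countable_basis by blast
    moreover from this have "\<exists>V\<in>\<B>. p \<in> V \<and> V \<subseteq> U" if "open U" "p \<in> U" for U p
      using that by (meson topological_basisE)
    ultimately show ?thesis
      unfolding second_countable_def by (metis open_openin topological_basis_open)
  qed
  then show ?thesis
    by (simp add: oriented_surface_def is_chart_id oriented_transition_id)
qed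

lemma coordinate_system_id: "coordinate_system euclidean standard_atlas (UNIV, id)"
  by (simp add: coordinate_system_def is_chart_id oriented_transition_id)

lemma singular_set_plane: "singular_set euclidean standard_atlas f = {p. \<not> inj (frechet_derivative f (at p))}"
  by (auto simp: singular_set_def immersion_at_def)

text \<open>An arbitrary oriented coordinate system of the plane, read backwards: a smooth orientation
  preserving parametrization. The limiting normal curvature is defined through an unspecified
  coordinate system, so it has to be computed in all of them.\<close>
lemma coordinate_system_plane_inverse:
  assumes "coordinate_system euclidean standard_atlas c" "p \<in> fst c"
  defines "g \<equiv> chart_inv c" and "V \<equiv> snd c ` fst c"
  shows "open V" "snd c p \<in> V" "\<And>q. q \<in> fst c \<Longrightarrow> g (snd c q) = q" "\<And>z. z \<in> V \<Longrightarrow> snd c (g z) = z"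
    "smooth_on V g" "det (matrix (frechet_derivative g (at (snd c p)))) > 0"
proof -
  have chart: "is_chart euclidean c" and trans: "oriented_transition c (UNIV, id)"
    using assms(1) by (auto simp: coordinate_system_def)
  show "open V" using chart by (simp add: is_chart_def V_def)
  show p: "snd c p \<in> V" using assms(2) by (simp add: V_def)
  have "inj_on (snd c) (fst c)"
    using chart homeomorphic_imp_injective_map by (fastforce simp: is_chart_def)
  then show "g (snd c q) = q" if "q \<in> fst c" for q
    using that by (simp add: g_def chart_inv_def)
  show "snd c (g z) = z" if "z \<in> V" for z
    using that by (simp add: g_def V_def chart_inv_def f_inv_into_f)
  have "id \<circ> g = g" "chart_image c UNIV = V" by (auto simp: chart_image_def V_def)
  with trans p show "smooth_on V g" "det (matrix (frechet_derivative g (at (snd c p)))) > 0"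
    by (auto simp: oriented_transition_def g_def)
qed

section \<open>Translation surfaces with a singular profile\<close>

lemma vector_3_eq: "(vector [a, b, c] :: real^3) = a *\<^sub>R axis 1 1 + b *\<^sub>R axis 2 1 + c *\<^sub>R axis 3 1"
  by (simp add: vec_eq_iff forall_3 axis_def)

lemma inner_vector_3: "(vector [a, b, c] :: real^3) \<bullet> vector [a', b', c'] = a * a' + b * b' + c * c'"
  by (simp add: inner_vec_def sum_3)

lemma smooth_on_coord: "smooth_on UNIV g \<Longrightarrow> smooth_on S (\<lambda>q::real^2. g (q $ i))" if "open S"
  for g :: "real \<Rightarrow> real"
  by (rule smooth_on_compose[OF that open_UNIV _ smooth_on_linear[OF that bounded_linear_vec_nth]]) auto

lemma smooth_on_vector_3:
  assumes "open S" "smooth_on S a" "smooth_on S b" "smooth_on S c"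
  shows "smooth_on S (\<lambda>q. vector [a q, b q, c q] :: real^3)"
  unfolding vector_3_eq
  by (intro smooth_on_add smooth_on_scaleR smooth_on_const assms)

definition translation_surface ::
    "(real \<Rightarrow> real) \<Rightarrow> real \<Rightarrow> (real \<Rightarrow> real) \<Rightarrow> (real \<Rightarrow> real) \<Rightarrow> real^2 \<Rightarrow> real^3" where
  "translation_surface x c y w q = vector [x (q $ 1), y (q $ 2), c * (q $ 1)\<^sup>2 / 2 + w (q $ 2)]"

text \<open>The profile has velocity \<open>t (X t, 0, c)\<close>, a singular point at \<open>t = 0\<close> with limiting direction
  \<open>(X 0, 0, c)\<close>. The last assumption says that the plane directrix \<open>(y, w)\<close> has nonvanishing curvature.
  Together with \<open>X 0 \<noteq> 0\<close>, which keeps the limiting tangent plane transversal to the plane of the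
  directrix, it makes the limiting normal curvature nonzero.\<close>
locale cuspidal_translation =
  fixes x X :: "real \<Rightarrow> real" and c :: real and y y' y'' w w' w'' :: "real \<Rightarrow> real"
  assumes x: "(x has_real_derivative t * X t) (at t)"
    and y: "(y has_real_derivative y' t) (at t)" and y': "(y' has_real_derivative y'' t) (at t)"
    and w: "(w has_real_derivative w' t) (at t)" and w': "(w' has_real_derivative w'' t) (at t)"
    and smooth_X: "smooth_on UNIV X" and smooth_y': "smooth_on UNIV y'" and smooth_w': "smooth_on UNIV w'"
    and c: "c \<noteq> 0" and X0: "X 0 \<noteq> 0" and y'_nz: "y' t \<noteq> 0"
    and curved: "y' t * w'' t - w' t * y'' t \<noteq> 0"
begin

abbreviation "f \<equiv> translation_surface x c y w"

definition profile_dir :: "real \<Rightarrow> real^3" where "profile_dir t = vector [X t, 0, c]"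

definition directrix_dir :: "real \<Rightarrow> real^3" where "directrix_dir t = vector [0, y' t, w' t]"

lemma f_has_derivative:
  "(f has_derivative (\<lambda>h. (h $ 1 * q $ 1) *\<^sub>R profile_dir (q $ 1) + h $ 2 *\<^sub>R directrix_dir (q $ 2))) (at q)"
proof -
  note x' = x[unfolded has_field_derivative_def] and y = y[unfolded has_field_derivative_def]
    and w = w[unfolded has_field_derivative_def]
  note c1 = bounded_linear_imp_has_derivative[OF bounded_linear_vec_nth[of 1]]
    and c2 = bounded_linear_imp_has_derivative[OF bounded_linear_vec_nth[of 2]]
  have "((\<lambda>t. c * t\<^sup>2 / 2) has_real_derivative c * t) (at t)" for t :: real
    by (auto intro!: derivative_eq_intros)
  note sq = has_derivative_compose[OF c1 this[unfolded has_field_derivative_def]]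
  show ?thesis
    unfolding translation_surface_def[abs_def] vector_3_eq profile_dir_def directrix_dir_def
    by (rule has_derivative_eq_rhs[OF has_derivative_add[OF has_derivative_add[OF
              has_derivative_scaleR_left[OF has_derivative_compose[OF c1 x']]
              has_derivative_scaleR_left[OF has_derivative_compose[OF c2 y]]]
              has_derivative_scaleR_left[OF has_derivative_add[OF sq has_derivative_compose[OF c2 w]]]]])
      (auto simp: fun_eq_iff algebra_simps)
qed

lemma frechet_f:
  "frechet_derivative f (at q) = (\<lambda>h. (h $ 1 * q $ 1) *\<^sub>R profile_dir (q $ 1) + h $ 2 *\<^sub>R directrix_dir (q $ 2))"
  using frechet_derivative_at[OF f_has_derivative] by simp

lemma smooth_on_x: "smooth_on UNIV x"
  by (rule smooth_on_antiderivative[OF open_UNIV x smooth_on_mult[OF open_UNIV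
          smooth_on_linear[OF open_UNIV bounded_linear_ident] smooth_X]])

lemma smooth_on_f: "smooth_on UNIV f"
proof -
  have "smooth_on UNIV (\<lambda>t. c * t\<^sup>2 / 2)"
    by (rule smooth_on_antiderivative[OF open_UNIV _ smooth_on_mult[OF open_UNIV
            smooth_on_const[OF open_UNIV, of c] smooth_on_linear[OF open_UNIV bounded_linear_ident]]])
      (auto intro!: derivative_eq_intros)
  then show ?thesis
    unfolding translation_surface_def[abs_def]
    by (intro smooth_on_vector_3 smooth_on_add smooth_on_coord[of UNIV x] smooth_on_coord[of UNIV y]
        smooth_on_coord[of UNIV w] smooth_on_coord[of UNIV "\<lambda>t. c * t\<^sup>2 / 2"] open_UNIV smooth_on_x
        smooth_on_antiderivative[OF open_UNIV y smooth_y'] smooth_on_antiderivative[OF open_UNIV w smooth_w'])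
qed

text \<open>The cross product of \<open>profile_dir\<close> and \<open>directrix_dir\<close>.\<close>
definition normal_vec :: "real^2 \<Rightarrow> real^3" where
  "normal_vec q = vector [- c * y' (q $ 2), - X (q $ 1) * w' (q $ 2), X (q $ 1) * y' (q $ 2)]"

lemma normal_vec_perp: "profile_dir (q $ 1) \<bullet> normal_vec q = 0" "directrix_dir (q $ 2) \<bullet> normal_vec q = 0"
  by (simp_all add: profile_dir_def directrix_dir_def normal_vec_def inner_vector_3)

lemma normal_vec_norm_pos: "normal_vec q \<bullet> normal_vec q > 0"
  using c y'_nz by (simp add: normal_vec_def vec_eq_iff forall_3)

lemma smooth_on_normal_vec: "smooth_on UNIV normal_vec"
  unfolding normal_vec_def[abs_def]
  by (intro smooth_on_vector_3 smooth_on_mult smooth_on_const smooth_on_coord[of UNIV X]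
      smooth_on_coord[of UNIV y'] smooth_on_coord[of UNIV w'] smooth_on_coord[of UNIV "\<lambda>t. - X t"]
      open_UNIV smooth_X smooth_y' smooth_w'
      smooth_on_mult[OF open_UNIV smooth_on_const[OF open_UNIV, of "- 1"] smooth_X, simplified])

lemma unit_normal_normalized:
  "unit_normal_on standard_atlas f UNIV (\<lambda>q. (normal_vec q \<bullet> normal_vec q) powr (- 1 / 2) *\<^sub>R normal_vec q)"
proof -
  have NN: "smooth_on UNIV (\<lambda>q. normal_vec q \<bullet> normal_vec q)"
    unfolding normal_vec_def inner_vector_3
    by (intro smooth_on_add smooth_on_mult smooth_on_const smooth_on_coord[of UNIV X]
      smooth_on_coord[of UNIV y'] smooth_on_coord[of UNIV w'] smooth_on_coord[of UNIV "\<lambda>t. - X t"]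
      open_UNIV smooth_X smooth_y' smooth_w'
      smooth_on_mult[OF open_UNIV smooth_on_const[OF open_UNIV, of "- 1"] smooth_X, simplified])
  have "smooth_on UNIV (\<lambda>q. (normal_vec q \<bullet> normal_vec q) powr (- 1 / 2))"
    by (rule smooth_on_compose[OF open_UNIV open_greaterThan _ NN smooth_on_powr]) (use normal_vec_norm_pos in auto)
  then have "smooth_on UNIV (\<lambda>q. (normal_vec q \<bullet> normal_vec q) powr (- 1 / 2) *\<^sub>R normal_vec q)"
    by (intro smooth_on_scaleR smooth_on_normal_vec open_UNIV)
  moreover have "norm ((normal_vec q \<bullet> normal_vec q) powr (- 1 / 2) *\<^sub>R normal_vec q) = 1" for q
    using normal_vec_norm_pos[of q]
    by (simp add: norm_eq_sqrt_inner powr_minus_divide powr_half_sqrt)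
  ultimately show ?thesis
    by (simp add: unit_normal_on_def smooth_map_on_def frechet_f inner_add_left normal_vec_perp)
qed

lemma directrix_dir_nz: "directrix_dir t \<noteq> 0"
  using y'_nz by (simp add: directrix_dir_def vec_eq_iff forall_3)

lemma inj_frechet_f_iff: "inj (frechet_derivative f (at q)) \<longleftrightarrow> q $ 1 \<noteq> 0"
proof
  assume inj: "inj (frechet_derivative f (at q))"
  show "q $ 1 \<noteq> 0"
  proof
    assume "q $ 1 = 0"
    then have "frechet_derivative f (at q) (axis 1 1) = frechet_derivative f (at q) 0"
      by (simp add: frechet_f axis_def)
    with inj have "axis 1 1 = (0 :: real^2)" by (rule injD)
    then show False by (simp add: axis_eq_0_iff)
  qed
next
  assume q: "q $ 1 \<noteq> 0"
  show "inj (frechet_derivative f (at q))"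
    using q c y'_nz by (intro injI) (auto simp: frechet_f profile_dir_def directrix_dir_def vec_eq_iff forall_3 forall_2)
qed

lemma singular_set_f: "singular_set euclidean standard_atlas f = {q. q $ 1 = 0}"
  by (simp add: singular_set_plane inj_frechet_f_iff)

lemma frontal_f: "frontal euclidean standard_atlas f"
proof -
  have "p \<in> closure {q::real^2. q $ 1 \<noteq> 0}" for p
  proof (rule ccontr)
    assume "p \<notin> closure {q. q $ 1 \<noteq> 0}"
    then have "p \<in> interior {q. axis 1 1 \<bullet> q = (0::real)}"
      by (simp add: closure_interior inner_axis' Compl_eq)
    then show False by (simp add: interior_hyperplane axis_eq_0_iff)
  qed
  then have "is_surface euclidean standard_atlas f"
    using smooth_on_f by (auto simp: is_surface_def smooth_map_on_def singular_set_f Compl_eq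
        Compl_eq_Diff_UNIV[symmetric])
  with unit_normal_normalized show ?thesis by (auto simp: frontal_def)
qed

lemma rank_one_f:
  assumes "q $ 1 = 0"
  shows "rank_one_at standard_atlas f q"
proof -
  have "range (frechet_derivative f (at q)) = span {directrix_dir (q $ 2)}"
    using assms by (auto simp: frechet_f span_singleton intro!: image_eqI[of _ _ "axis 2 _"])
  then show ?thesis by (simp add: rank_one_at_def directrix_dir_nz dim_insert)
qed

lemma differential_f:
  assumes "coordinate_system euclidean standard_atlas \<kappa>" "z \<in> snd \<kappa> ` fst \<kappa>"
  defines "g \<equiv> chart_inv \<kappa>"
  shows "differential \<kappa> f (g z) h =
    (frechet_derivative g (at z) h $ 1 * g z $ 1) *\<^sub>R profile_dir (g z $ 1) +
    frechet_derivative g (at z) h $ 2 *\<^sub>R directrix_dir (g z $ 2)"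
proof -
  obtain p where "p \<in> fst \<kappa>" using assms(2) by blast
  note inv = coordinate_system_plane_inverse[OF assms(1) this, folded g_def]
  have "((f \<circ> g) has_derivative (\<lambda>h. (frechet_derivative g (at z) h $ 1 * g z $ 1) *\<^sub>R profile_dir (g z $ 1) +
      frechet_derivative g (at z) h $ 2 *\<^sub>R directrix_dir (g z $ 2))) (at z)"
    using has_derivative_compose[OF smooth_on_has_derivative[OF inv(5) assms(2)] f_has_derivative]
    by (simp add: o_def)
  note frechet_derivative_at[OF this, symmetric]
  then show ?thesis
    by (simp add: differential_def inv(4)[OF assms(2)] flip: g_def)
qed

text \<open>Along the singular line the factor \<open>u\<close> of the profile velocity vanishes. Of the second derivative there
  remain a multiple of \<open>profile_dir 0\<close>, a multiple of \<open>directrix_dir\<close> and the acceleration of the directrix, the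
  last with the square of the \<open>v\<close>-component of the coordinate direction as coefficient. Only the
  acceleration contributes to the normal component.\<close>
lemma second_derivative_f:
  assumes \<kappa>: "coordinate_system euclidean standard_atlas \<kappa>" and p: "p \<in> fst \<kappa>" "p $ 1 = 0"
    and n: "profile_dir 0 \<bullet> n = 0" "directrix_dir (p $ 2) \<bullet> n = 0"
  shows "deriv_v \<kappa> (deriv_v \<kappa> f) p \<bullet> n =
    (frechet_derivative (chart_inv \<kappa>) (at (snd \<kappa> p)) (axis 2 1) $ 2)\<^sup>2 *
      (vector [0, y'' (p $ 2), w'' (p $ 2)] \<bullet> n)"
proof -
  define g where "g = chart_inv \<kappa>"
  define a where "a = snd \<kappa> p"
  define V where "V = snd \<kappa> ` fst \<kappa>"
  define e :: "real^2" where "e = axis 2 1"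
  define D where "D z = frechet_derivative g (at z) e" for z
  note inv = coordinate_system_plane_inverse[OF \<kappa> p(1), folded g_def a_def V_def]
  have ga: "g a = p" using inv(3)[OF p(1)] by (simp add: a_def)
  let ?H = "\<lambda>z. (D z $ 1 * g z $ 1) *\<^sub>R profile_dir (g z $ 1) + D z $ 2 *\<^sub>R directrix_dir (g z $ 2)"
  have H: "(deriv_v \<kappa> f \<circ> g) z = ?H z" if "z \<in> V" for z
    using differential_f[OF \<kappa>] that by (simp add: deriv_v_def D_def e_def V_def g_def)
  have g': "(g has_derivative frechet_derivative g (at a)) (at a)"
    by (rule smooth_on_has_derivative[OF inv(5,2)])
  obtain D' where D': "(D has_derivative D') (at a)"
    unfolding D_def using smooth_on_has_derivative[OF smooth_on_frechet_derivative[OF inv(5)] inv(2)] by blast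
  note nth = bounded_linear.has_derivative[OF bounded_linear_vec_nth]
  have "(profile_dir has_derivative (\<lambda>r. frechet_derivative X (at t) r *\<^sub>R axis 1 1)) (at t)" for t
  proof -
    have "(X has_derivative frechet_derivative X (at t)) (at t)"
      by (rule smooth_on_has_derivative[OF smooth_X]) simp
    then show ?thesis
      unfolding profile_dir_def[abs_def] vector_3_eq
      by (auto intro!: derivative_eq_intros)
  qed
  note A' = has_derivative_compose[OF nth[OF g'] this]
  have "(directrix_dir has_derivative (\<lambda>r. r *\<^sub>R vector [0, y'' t, w'' t])) (at t)" for t
    unfolding directrix_dir_def[abs_def] vector_3_eq
    using y'[unfolded has_field_derivative_def, of t] w'[unfolded has_field_derivative_def, of t]
    by (auto intro!: derivative_eq_intros simp: algebra_simps)
  note B' = has_derivative_compose[OF nth[OF g'] this]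
  note H' = has_derivative_add[OF
      has_derivative_scaleR[OF has_derivative_mult[OF nth[OF D'] nth[OF g']] A']
      has_derivative_scaleR[OF nth[OF D'] B']]
  have "(?H has_derivative
      (\<lambda>h. (D a $ 1 * frechet_derivative g (at a) h $ 1) *\<^sub>R profile_dir 0 + (D' h $ 2) *\<^sub>R directrix_dir (p $ 2) +
         (D a $ 2 * frechet_derivative g (at a) h $ 2) *\<^sub>R vector [0, y'' (p $ 2), w'' (p $ 2)])) (at a)"
    by (rule has_derivative_eq_rhs[OF H']) (auto simp: ga p(2) fun_eq_iff)
  from has_derivative_transform_within_open[OF this inv(1,2) H[symmetric]]
  have "((deriv_v \<kappa> f \<circ> g) has_derivative
      (\<lambda>h. (D a $ 1 * frechet_derivative g (at a) h $ 1) *\<^sub>R profile_dir 0 + (D' h $ 2) *\<^sub>R directrix_dir (p $ 2) +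
         (D a $ 2 * frechet_derivative g (at a) h $ 2) *\<^sub>R vector [0, y'' (p $ 2), w'' (p $ 2)])) (at a)" .
  note frechet_derivative_at[OF this, symmetric]
  then have "deriv_v \<kappa> (deriv_v \<kappa> f) p = (D a $ 1 * D a $ 1) *\<^sub>R profile_dir 0 + (D' e $ 2) *\<^sub>R directrix_dir (p $ 2) +
      (D a $ 2 * D a $ 2) *\<^sub>R vector [0, y'' (p $ 2), w'' (p $ 2)]"
    by (simp add: deriv_v_def differential_def flip: g_def a_def e_def D_def)
  then show ?thesis
    using n by (simp add: inner_add_left power2_eq_square D_def e_def flip: g_def a_def)
qed

text \<open>The differential at a singular point does not see \<open>profile_dir\<close>. Orthogonality to it is inherited by
  continuity from the regular points \<open>(t, p\<^sub>2)\<close> with \<open>t \<rightarrow> 0\<close>, where the factor \<open>t\<close> can be cancelled.\<close>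
lemma normal_f:
  assumes D: "open D" "p \<in> D" and \<nu>: "unit_normal_on standard_atlas f D \<nu>" and p: "p $ 1 = 0"
  shows "profile_dir 0 \<bullet> \<nu> p = 0" "directrix_dir (p $ 2) \<bullet> \<nu> p = 0" "\<nu> p \<noteq> 0"
proof -
  have perp: "(h $ 1 * q $ 1) * (profile_dir (q $ 1) \<bullet> \<nu> q) + h $ 2 * (directrix_dir (q $ 2) \<bullet> \<nu> q) = 0"
    if "q \<in> D" for q and h :: "real^2"
    using \<nu> that by (simp add: unit_normal_on_def frechet_f inner_add_left)
  show "directrix_dir (p $ 2) \<bullet> \<nu> p = 0"
    using perp[OF D(2), of "axis 2 1"] by (simp add: axis_def)
  show "\<nu> p \<noteq> 0" using \<nu> D(2) by (auto simp: unit_normal_on_def)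
  define l where "l = (\<lambda>t::real. p + t *\<^sub>R axis 1 1)"
  have l: "(l \<longlongrightarrow> p) (at 0)"
    unfolding l_def by (auto intro!: tendsto_eq_intros)
  have "isCont \<nu> p"
    using \<nu> D smooth_on_continuous[of D \<nu>] by (simp add: unit_normal_on_def smooth_map_on_def continuous_on_eq_continuous_at)
  then have "((\<lambda>t. \<nu> (l t)) \<longlongrightarrow> \<nu> p) (at 0)"
    by (rule isCont_tendsto_compose[OF _ l])
  moreover have "(profile_dir \<longlongrightarrow> profile_dir 0) (at 0)"
  proof -
    have "isCont X 0"
      using smooth_on_continuous[OF smooth_X] by (simp add: continuous_on_eq_continuous_at)
    then show ?thesis
      unfolding profile_dir_def[abs_def] vector_3_eq by (auto intro!: tendsto_intros simp: isCont_def)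
  qed
  ultimately have "((\<lambda>t. profile_dir t \<bullet> \<nu> (l t)) \<longlongrightarrow> profile_dir 0 \<bullet> \<nu> p) (at 0)"
    by (intro tendsto_inner)
  moreover have "\<forall>\<^sub>F t in at 0. profile_dir t \<bullet> \<nu> (l t) = 0"
  proof -
    have "\<forall>\<^sub>F t in at 0. l t \<in> D" using topological_tendstoD[OF l D] .
    moreover have "\<forall>\<^sub>F t in at 0. t \<noteq> (0::real)" by (simp add: eventually_at_filter)
    ultimately show ?thesis
    proof eventually_elim
      case (elim t)
      have "l t $ 1 = t" by (simp add: l_def p axis_def)
      with perp[OF elim(1), of "axis 1 1"] elim(2) show ?case by (simp add: axis_def)
    qed
  qed
  then have "((\<lambda>t. profile_dir t \<bullet> \<nu> (l t)) \<longlongrightarrow> 0) (at 0)"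
    by (rule tendsto_eventually)
  ultimately show "profile_dir 0 \<bullet> \<nu> p = 0"
    by (rule tendsto_unique[OF trivial_limit_at])
qed

text \<open>The acceleration of the directrix, \<open>profile_dir 0\<close> and \<open>directrix_dir t\<close> are linearly independent, so no
  nonzero vector is orthogonal to all three.\<close>
lemma curvature_nonzero:
  assumes "profile_dir 0 \<bullet> n = 0" "directrix_dir t \<bullet> n = 0" "n \<noteq> 0"
  shows "vector [0, y'' t, w'' t] \<bullet> n \<noteq> 0"
proof
  assume perp: "vector [0, y'' t, w'' t] \<bullet> n = 0"
  have 1: "X 0 * n $ 1 + c * n $ 3 = 0" and 2: "y' t * n $ 2 + w' t * n $ 3 = 0"
    and 3: "y'' t * n $ 2 + w'' t * n $ 3 = 0"
    using assms(1,2) perp by (simp_all add: profile_dir_def directrix_dir_def inner_vec_def sum_3)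
  have "(y' t * w'' t - w' t * y'' t) * n $ 3 =
      y' t * (y'' t * n $ 2 + w'' t * n $ 3) - y'' t * (y' t * n $ 2 + w' t * n $ 3)"
    by (simp add: algebra_simps)
  then have "n $ 3 = 0" using curved[of t] 2 3 by simp
  then have "n = 0" using 1 2 X0 y'_nz[of t] by (simp add: vec_eq_iff forall_3)
  with assms(3) show False by contradiction
qed

text \<open>In an adapted coordinate system the first coordinate direction spans the kernel of the
  differential, the \<open>u\<close>-axis. By invertibility of the coordinate change, the second direction then has a nonzero
  \<open>v\<close>-component.\<close>
lemma limiting_normal_curvature_f:
  assumes D: "open D" "p \<in> D" and \<nu>: "unit_normal_on standard_atlas f D \<nu>" and p: "p $ 1 = 0"
  shows "limiting_normal_curvature euclidean standard_atlas f \<nu> p \<noteq> 0"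
proof -
  define \<kappa> where "\<kappa> = (SOME \<kappa>. adapted_at euclidean standard_atlas f p \<kappa>)"
  have "adapted_at euclidean standard_atlas f p (UNIV, id)"
    by (simp add: adapted_at_def coordinate_system_id deriv_u_def frechet_f p axis_def)
  then have "adapted_at euclidean standard_atlas f p \<kappa>"
    unfolding \<kappa>_def by (rule someI)
  then have \<kappa>: "coordinate_system euclidean standard_atlas \<kappa>" "p \<in> fst \<kappa>" "deriv_u \<kappa> f p = 0"
    by (auto simp: adapted_at_def)
  define G where "G = frechet_derivative (chart_inv \<kappa>) (at (snd \<kappa> p))"
  note inv = coordinate_system_plane_inverse[OF \<kappa>(1,2)]
  have diff: "differential \<kappa> f p h = G h $ 2 *\<^sub>R directrix_dir (p $ 2)" for h
    using differential_f[OF \<kappa>(1) inv(2), of h] inv(3)[OF \<kappa>(2)] p by (simp add: G_def)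
  have "G (axis 1 1) $ 2 = 0"
    using \<kappa>(3) diff directrix_dir_nz by (simp add: deriv_u_def)
  moreover have "det (matrix G) > 0" using inv(6) by (simp add: G_def)
  ultimately have G: "G (axis 2 1) $ 2 \<noteq> 0" by (auto simp: det_2 matrix_def)
  have "deriv_v \<kappa> (deriv_v \<kappa> f) p \<bullet> \<nu> p \<noteq> 0"
    using second_derivative_f[OF \<kappa>(1,2) p normal_f(1,2)[OF D \<nu> p]] G
      curvature_nonzero[OF normal_f[OF D \<nu> p]] by (simp add: G_def)
  moreover have "deriv_v \<kappa> f p \<noteq> 0"
    using diff G directrix_dir_nz by (simp add: deriv_v_def)
  ultimately show ?thesis
    by (simp add: limiting_normal_curvature_def flip: \<kappa>_def)
qed

lemma generic_frontal_f: "generic_frontal euclidean standard_atlas f"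
  unfolding generic_frontal_def
  using frontal_f rank_one_f limiting_normal_curvature_f
  by (auto simp: singular_set_f intro: exI[of _ 0])

text \<open>The metric depends on the two curves only through \<open>X\<^sup>2 + c\<^sup>2\<close>, \<open>c w'\<close> and \<open>y'\<^sup>2 + w'\<^sup>2\<close>, which leaves room for
  an isometric partner with different heights.\<close>
lemma first_fundamental_form_f:
  "first_fundamental_form (UNIV, id) f q h k =
    (q $ 1)\<^sup>2 * ((X (q $ 1))\<^sup>2 + c\<^sup>2) * (h $ 1 * k $ 1) +
    q $ 1 * (c * w' (q $ 2)) * (h $ 1 * k $ 2 + h $ 2 * k $ 1) +
    ((y' (q $ 2))\<^sup>2 + (w' (q $ 2))\<^sup>2) * (h $ 2 * k $ 2)"
  by (simp add: first_fundamental_form_def frechet_f profile_dir_def directrix_dir_def inner_vec_def sum_3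
      power2_eq_square algebra_simps)

end

section \<open>A profile with infinitely many double points and its isometric partner\<close>

text \<open>The function \<open>F\<close> of the introduction: nonnegative, with zeros at \<open>1 / (2 \<pi> n)\<close>.\<close>
definition wiggle :: "real \<Rightarrow> real" where
  "wiggle = flat_function (\<lambda>s. 1 - cos s)"

text \<open>The derivative of \<open>wiggle\<close> divided by \<open>t\<close>, which is again flat and smooth.\<close>
definition wiggle_slope :: "real \<Rightarrow> real" where
  "wiggle_slope = flat_function (\<lambda>s. s * (s * (s * (1 - cos s - sin s))))"

text \<open>The function \<open>Y\<close> of the introduction. The even summand \<open>exp (- t\<^sup>2)\<close> is positive and strictly decreasing for
  \<open>t > 0\<close>; the monotonicity is what breaks the balance between the two profiles.\<close>
definition slope :: "real \<Rightarrow> real" where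
  "slope t = exp (- t\<^sup>2) + wiggle_slope t"

lemma wiggle_deriv: "(wiggle has_real_derivative t * wiggle_slope t) (at t)"
proof -
  have "(\<lambda>s. 1 - cos s) \<in> quasi_poly"
    using quasi_poly.add[OF quasi_poly.monomial[of 0] quasi_poly.scale[OF quasi_poly.cos[of 0], of "- 1"]]
    by simp
  moreover have "((\<lambda>s. 1 - cos s) has_real_derivative sin s) (at s)" for s :: real
    by (auto intro!: derivative_eq_intros)
  ultimately have "(wiggle has_real_derivative flat_function (\<lambda>s. s * (s * (1 - cos s - sin s))) t) (at t)"
    unfolding wiggle_def by (rule flat_function_deriv)
  moreover have "flat_function (\<lambda>s. s * (s * (1 - cos s - sin s))) t = t * wiggle_slope t"
    by (simp add: flat_function_def wiggle_slope_def)
  ultimately show ?thesis by simp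
qed

lemma smooth_on_slope: "smooth_on UNIV slope"
proof -
  have "(\<lambda>s. 1 - cos s - sin s) \<in> quasi_poly"
    using quasi_poly.add[OF quasi_poly.add[OF quasi_poly.monomial[of 0]
          quasi_poly.scale[OF quasi_poly.cos[of 0], of "- 1"]]
        quasi_poly.scale[OF quasi_poly.sin[of 0], of "- 1"]]
    by simp
  then have 1: "smooth_on UNIV wiggle_slope"
    unfolding wiggle_slope_def by (intro smooth_on_flat_function quasi_poly_times_id)
  have "smooth_on UNIV (\<lambda>t::real. - 1 * (t * t))"
    by (intro smooth_on_mult smooth_on_const smooth_on_linear open_UNIV bounded_linear_ident)
  then have "smooth_on UNIV (\<lambda>t::real. exp (- 1 * (t * t)))"
    by (rule smooth_on_compose[OF open_UNIV open_UNIV _ _ smooth_on_exp, rotated]) simp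
  then have 2: "smooth_on UNIV (\<lambda>t::real. exp (- t\<^sup>2))"
    by (simp add: power2_eq_square)
  show ?thesis
    unfolding slope_def[abs_def] by (rule smooth_on_add[OF open_UNIV 2 1])
qed

lemma wiggle_nonneg: "wiggle t \<ge> 0"
  by (simp add: wiggle_def flat_function_def)

lemma wiggle_nonpos [simp]: "t \<le> 0 \<Longrightarrow> wiggle t = 0" "t \<le> 0 \<Longrightarrow> wiggle_slope t = 0"
  by (simp_all add: wiggle_def wiggle_slope_def flat_function_def)

lemma wiggle_zero_at: "wiggle (1 / (2 * pi * real n)) = 0"
proof -
  have "cos (2 * pi * real n) = 1" using cos_2npi[of n] by (simp add: ac_simps)
  then show ?thesis by (simp add: wiggle_def flat_function_def)
qed

lemma wiggle_pos_near_zero: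
  assumes "u > 0"
  shows "\<exists>t. 0 < t \<and> t < u \<and> wiggle t > 0"
proof -
  obtain n where n: "inverse (real (Suc n)) < u" using reals_Archimedean[OF assms] by blast
  define t where "t = 1 / (real (2 * n + 1) * pi)"
  have "real (Suc n) * 1 \<le> real (2 * n + 1) * pi"
    using pi_gt3 by (intro mult_mono) auto
  then have "t \<le> inverse (real (Suc n))"
    unfolding t_def by (simp add: inverse_eq_divide frac_le)
  moreover have t: "t > 0" unfolding t_def by simp
  moreover have "cos (1 / t) = - 1"
    unfolding t_def using cos_npi[of "2 * n + 1"] by simp
  with t have "wiggle t > 0" by (simp add: wiggle_def flat_function_def)
  ultimately show ?thesis using n by (intro exI[of _ t]) auto
qed

text \<open>For \<open>t > 0\<close> we have \<open>slope (- t) = e t\<close>. The tangent of \<open>sqrt (1 + r\<^sup>2)\<close> at \<open>r = e t\<close> has slope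
  \<open>m t\<close>, so convexity gives \<open>sqrt (1 + (slope t)\<^sup>2) - sqrt (1 + (e t)\<^sup>2) \<ge> m t * wiggle_slope t\<close>. Subtracting
  \<open>m * wiggle\<close> from a quarter of \<open>x t - x (- t)\<close> therefore leaves a function \<open>K\<close> with
  \<open>K' \<ge> - m' * wiggle \<ge> 0\<close>: this is integration by parts without integrals. Strictness comes from the points
  close to 0 where \<open>wiggle\<close> is positive.\<close>
lemma partner_profile_asymmetric:
  assumes x: "\<And>t. (x has_real_derivative t * (4 * sqrt (1 + (slope t)\<^sup>2))) (at t)" and "u > 0"
  shows "x (- u) < x u"
proof -
  define e :: "real \<Rightarrow> real" where "e = (\<lambda>t. exp (- t\<^sup>2))"
  define m :: "real \<Rightarrow> real" where "m = (\<lambda>t. e t / sqrt (1 + (e t)\<^sup>2))"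
  define K where "K = (\<lambda>t. (x t - x (- t)) / 4 - m t * wiggle t)"
  define K' where "K' = (\<lambda>t. t * (sqrt (1 + (slope t)\<^sup>2) - sqrt (1 + (e t)\<^sup>2) - m t * wiggle_slope t)
    + 2 * t * e t / (sqrt (1 + (e t)\<^sup>2)) ^ 3 * wiggle t)"
  have e_pos: "e t > 0" for t by (simp add: e_def)
  have sq: "1 + (e t)\<^sup>2 > 0" for t by (simp add: add_pos_nonneg)
  have e': "(e has_real_derivative - 2 * t * e t) (at t)" for t
    unfolding e_def by (auto intro!: derivative_eq_intros)
  have q': "((\<lambda>r. r / sqrt (1 + r\<^sup>2)) has_real_derivative 1 / (sqrt (1 + r\<^sup>2)) ^ 3) (at r)" for r :: real
  proof -
    have p: "1 + r\<^sup>2 > 0" by (simp add: add_pos_nonneg)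
    define S where "S = sqrt (1 + r\<^sup>2)"
    have S: "S > 0" "S * S = 1 + r * r" using p by (simp_all add: S_def flip: power2_eq_square)
    have "((\<lambda>r. sqrt (1 + r\<^sup>2)) has_real_derivative r / S) (at r)"
      unfolding S_def using p by (auto intro!: derivative_eq_intros simp: field_simps)
    from DERIV_divide[OF DERIV_ident this]
    have "((\<lambda>r. r / sqrt (1 + r\<^sup>2)) has_real_derivative (1 * S - r * (r / S)) / (S * S)) (at r)"
      using S(1) by (simp add: S_def)
    moreover have "(1 * S - r * (r / S)) / (S * S) = (S * S - r * r) / (S * S * S)"
      using S(1) by (simp add: field_simps)
    then have "(1 * S - r * (r / S)) / (S * S) = 1 / S ^ 3"
      unfolding power3_eq_cube using S(2) by simp
    ultimately show ?thesis by (simp only: S_def)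
  qed
  have m': "(m has_real_derivative - 2 * t * e t / (sqrt (1 + (e t)\<^sup>2)) ^ 3) (at t)" for t
    unfolding m_def using DERIV_chain2[OF q' e', of t] by simp
  have x_neg: "((\<lambda>t. x (- t)) has_real_derivative t * (4 * sqrt (1 + (slope (- t))\<^sup>2))) (at t)" for t
    by (rule DERIV_cong[OF DERIV_chain2[OF x DERIV_minus[OF DERIV_ident]]]) simp
  have K: "(K has_real_derivative K' t) (at t)" if "t \<ge> 0" for t
  proof -
    have s: "slope (- t) = e t" using that by (simp add: slope_def e_def)
    have "(K has_real_derivative
        (t * (4 * sqrt (1 + (slope t)\<^sup>2)) - t * (4 * sqrt (1 + (slope (- t))\<^sup>2))) / 4 -
        (- 2 * t * e t / (sqrt (1 + (e t)\<^sup>2)) ^ 3 * wiggle t + t * wiggle_slope t * m t)) (at t)"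
      unfolding K_def by (rule DERIV_diff[OF DERIV_cdivide[OF DERIV_diff[OF x x_neg]] DERIV_mult[OF m' wiggle_deriv]])
    then show ?thesis by (rule DERIV_cong) (simp add: K'_def s diff_divide_distrib algebra_simps)
  qed
  have convex: "sqrt (1 + (e t)\<^sup>2) + m t * wiggle_slope t \<le> sqrt (1 + (slope t)\<^sup>2)" for t
  proof -
    define a where "a = sqrt (1 + (e t)\<^sup>2)"
    have a: "a > 0" "a * a = 1 + e t * e t" using sq[of t] by (simp_all add: a_def flip: power2_eq_square)
    \<comment> \<open>The Cauchy-Schwarz inequality states that \<open>sqrt (1 + r\<^sup>2)\<close> lies above its tangents.\<close>
    have "1 + e t * slope t \<le> sqrt (1\<^sup>2 + (e t)\<^sup>2) * sqrt (1\<^sup>2 + (slope t)\<^sup>2)"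
      using norm_cauchy_schwarz[of "(1::real, e t)" "(1, slope t)"] by (simp add: norm_prod_def)
    then have "1 + e t * slope t \<le> a * sqrt (1 + (slope t)\<^sup>2)" by (simp add: a_def)
    moreover have "slope t = e t + wiggle_slope t" "a * m t = e t"
      using a(1) by (simp_all add: slope_def e_def m_def a_def)
    then have "1 + e t * slope t = a * (a + m t * wiggle_slope t)"
      using a(2) by (simp add: distrib_left flip: mult.assoc)
    ultimately show ?thesis using a(1) by (simp add: a_def)
  qed
  have K'_ge: "2 * t * e t / (sqrt (1 + (e t)\<^sup>2)) ^ 3 * wiggle t \<le> K' t" if "t \<ge> 0" for t
    using convex[of t] that by (simp add: K'_def)
  have K'_nonneg: "0 \<le> K' t" if "t \<ge> 0" for t
    using K'_ge[OF that] that e_pos[of t] wiggle_nonneg[of t] sq[of t]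
    by (smt (verit) divide_nonneg_nonneg mult_nonneg_nonneg real_sqrt_ge_zero zero_le_power)
  have mono: "K s \<le> K t" if "0 \<le> s" "s \<le> t" for s t
    using that K K'_nonneg by (intro DERIV_nonneg_imp_nondecreasing[OF that(2)]) (meson order_trans)
  have K0: "K 0 = 0" by (simp add: K_def)
  obtain t where t: "0 < t" "t < u" "wiggle t > 0" using wiggle_pos_near_zero[OF \<open>u > 0\<close>] by blast
  have "0 < 2 * t * e t / (sqrt (1 + (e t)\<^sup>2)) ^ 3 * wiggle t"
    using t e_pos[of t] sq[of t] by simp
  then have "K' t > 0" using K'_ge[of t] t(1) by linarith
  from DERIV_pos_inc_right[OF K this] t(1) obtain d where d: "d > 0" "\<And>h. 0 < h \<Longrightarrow> h < d \<Longrightarrow> K t < K (t + h)"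
    by auto
  define h where "h = min (d / 2) (u - t)"
  have h: "0 < h" "h < d" "t + h \<le> u" using d(1) t by (auto simp: h_def)
  have "0 \<le> K t" using mono[of 0 t] K0 t by simp
  also have "K t < K (t + h)" using d(2) h by blast
  also have "\<dots> \<le> K u" using mono h t by simp
  finally have "K u > 0" .
  moreover have "m u * wiggle u \<ge> 0" using e_pos[of u] wiggle_nonneg[of u] sq[of u]
    by (simp add: m_def)
  ultimately show ?thesis by (simp add: K_def)
qed

section \<open>Isometric frontals that are not A-equivalent\<close>

text \<open>Diffeomorphism germs are injective, so composing with them on either side creates no double points
  near \<open>p\<close>. Local injectivity is the invariant that separates the two frontals.\<close>
lemma A_equivalent_at_preserves_local_injectivity:
  assumes "A_equivalent_at X A f1 f2 p" "inj_on f1 (topspace X)"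
  shows "\<exists>U. openin X U \<and> p \<in> U \<and> inj_on f2 U"
proof -
  obtain V W \<phi> \<phi>' V' W' \<Phi> \<Phi>' U where
    src: "source_diffeo_germ X A p V W \<phi> \<phi>'" and tgt: "target_diffeo_germ (f1 p) (f2 p) V' W' \<Phi> \<Phi>'"
    and U: "openin X U" "p \<in> U" "U \<subseteq> W" and eq: "\<And>q. q \<in> U \<Longrightarrow> f1 (\<phi>' q) \<in> V' \<and> f2 q = \<Phi> (f1 (\<phi>' q))"
    using assms(1) unfolding A_equivalent_at_def by blast
  have "homeomorphic_maps (subtopology X V) (subtopology X W) \<phi> \<phi>'" and W: "openin X W"
    using src by (auto simp: source_diffeo_germ_def)
  then have \<phi>': "\<And>q. q \<in> W \<Longrightarrow> \<phi>' q \<in> topspace X" "\<And>q. q \<in> W \<Longrightarrow> \<phi> (\<phi>' q) = q"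
    using openin_subset[OF W] by (auto simp: homeomorphic_maps_def continuous_map_def)
  have \<Phi>: "\<And>r. r \<in> V' \<Longrightarrow> \<Phi>' (\<Phi> r) = r"
    using tgt by (auto simp: target_diffeo_germ_def homeomorphism_def)
  have "inj_on f2 U"
  proof (rule inj_onI)
    fix q r assume q: "q \<in> U" and r: "r \<in> U" and "f2 q = f2 r"
    then have "\<Phi> (f1 (\<phi>' q)) = \<Phi> (f1 (\<phi>' r))" using eq by metis
    then have "f1 (\<phi>' q) = f1 (\<phi>' r)" using \<Phi> eq q r by metis
    then have "\<phi>' q = \<phi>' r" using assms(2) \<phi>'(1) U(3) q r by (meson inj_onD subsetD)
    then show "q = r" using \<phi>'(2) U(3) q r by (metis subsetD)
  qed
  with U show ?thesis by blast
qed

theorem corollary4p9: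
  shows "\<exists>(X :: (real^2) topology) (A :: (real^2) chart set)
            (f1 :: real^2 \<Rightarrow> real^3) (f2 :: real^2 \<Rightarrow> real^3) (p :: real^2).
     oriented_surface X A \<and>
     generic_frontal X A f1 \<and> generic_frontal X A f2 \<and>
     isometric A f1 f2 \<and>
     p \<in> singular_set X A f1 \<and>
     \<not> A_equivalent_at X A f1 f2 p"
proof -
  let ?Y = slope
  let ?X1 = "\<lambda>t. 4 * sqrt (1 + (?Y t)\<^sup>2)" and ?X2 = "\<lambda>t. 4 * ?Y t"
  have "smooth_on UNIV (\<lambda>t. 1 + ?Y t * ?Y t)"
    by (intro smooth_on_add smooth_on_mult smooth_on_const smooth_on_slope open_UNIV)
  then have "smooth_on UNIV (\<lambda>t. (1 + ?Y t * ?Y t) powr (1 / 2))"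
    by (rule smooth_on_compose[OF open_UNIV open_greaterThan _ _ smooth_on_powr, rotated])
      (auto simp: add_pos_nonneg)
  then have smooth_X1: "smooth_on UNIV ?X1"
    by (intro smooth_on_mult smooth_on_const open_UNIV) (simp add: powr_half_sqrt power2_eq_square)
  have smooth_X2: "smooth_on UNIV ?X2"
    by (intro smooth_on_mult smooth_on_const smooth_on_slope open_UNIV)
  \<comment> \<open>The first profile enters only through its derivative, so any antiderivative will do.\<close>
  obtain x1 where x1: "\<And>t. (x1 has_real_derivative t * ?X1 t) (at t)"
    using ex_antiderivative[OF continuous_on_mult[OF continuous_on_id smooth_on_continuous[OF smooth_X1]]]
    by blast
  define x2 where "x2 = (\<lambda>t. 4 * (wiggle t - exp (- t\<^sup>2) / 2))"
  have x2: "(x2 has_real_derivative t * ?X2 t) (at t)" for t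
    unfolding x2_def
    by (auto intro!: derivative_eq_intros wiggle_deriv simp: slope_def algebra_simps)
  have slope0: "?Y 0 = 1" by (simp add: slope_def)
  have hyp: "smooth_on UNIV (\<lambda>t::real. a * sinh t)" "smooth_on UNIV (\<lambda>t::real. a * cosh t)" for a
    using smooth_on_sinh_cosh[of a 0] smooth_on_sinh_cosh[of 0 a] by simp_all
  interpret E1: cuspidal_translation x1 ?X1 3 "\<lambda>t. 4 * t" "\<lambda>_. 4" "\<lambda>_. 0"
    "\<lambda>t. 5 * cosh t" "\<lambda>t. 5 * sinh t" "\<lambda>t. 5 * cosh t"
    by unfold_locales
      (use x1 smooth_X1 hyp slope0 in \<open>auto intro!: derivative_eq_intros smooth_on_const\<close>)
  interpret E2: cuspidal_translation x2 ?X2 5 "\<lambda>t. 4 * sinh t" "\<lambda>t. 4 * cosh t" "\<lambda>t. 4 * sinh t"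
    "\<lambda>t. 3 * cosh t" "\<lambda>t. 3 * sinh t" "\<lambda>t. 3 * cosh t"
  proof unfold_locales
    fix t :: real
    have "4 * cosh t * (3 * cosh t) - 3 * sinh t * (4 * sinh t) = 12"
      using cosh_square_eq[of t] by (simp add: power2_eq_square)
    then show "4 * cosh t * (3 * cosh t) - 3 * sinh t * (4 * sinh t) \<noteq> 0" by simp
  qed (use x2 smooth_X2 hyp slope0 in \<open>auto intro!: derivative_eq_intros\<close>)
  have "isometric standard_atlas E1.f E2.f"
  proof -
    have "first_fundamental_form (UNIV, id) E1.f q h k = first_fundamental_form (UNIV, id) E2.f q h k" for q h k
    proof -
      \<comment> \<open>The Pythagorean triple 3, 4, 5 makes the partner of \<open>(4 v, 5 cosh v)\<close> explicit.\<close>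
      have 1: "(?X1 (q $ 1))\<^sup>2 + 3\<^sup>2 = (?X2 (q $ 1))\<^sup>2 + 5\<^sup>2"
        by (simp add: power_mult_distrib add_nonneg_nonneg)
      have 2: "4\<^sup>2 + (5 * sinh (q $ 2))\<^sup>2 = (4 * cosh (q $ 2))\<^sup>2 + (3 * sinh (q $ 2))\<^sup>2"
        by (simp add: power_mult_distrib cosh_square_eq)
      show ?thesis
        unfolding E1.first_fundamental_form_f E2.first_fundamental_form_f 1 2 by simp
    qed
    then show ?thesis by (auto simp: isometric_def fun_eq_iff)
  qed
  moreover have "inj E1.f"
  proof (rule injI)
    fix q r assume "E1.f q = E1.f r"
    then have 1: "x1 (q $ 1) = x1 (r $ 1)" and 2: "q $ 2 = r $ 2" and "(q $ 1)\<^sup>2 = (r $ 1)\<^sup>2"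
      by (auto simp: translation_surface_def vec_eq_iff forall_3)
    then have "q $ 1 = r $ 1 \<or> q $ 1 = - r $ 1" by (simp add: power2_eq_iff)
    then consider "q $ 1 = r $ 1" | "- r $ 1 = q $ 1" "r $ 1 > 0" | "- q $ 1 = r $ 1" "q $ 1 > 0"
      by linarith
    then have "q $ 1 = r $ 1"
    proof cases
      case 2
      then show ?thesis using partner_profile_asymmetric[OF x1, of "r $ 1"] 1 by simp
    next
      case 3
      then show ?thesis using partner_profile_asymmetric[OF x1, of "q $ 1"] 1 by simp
    qed
    with 2 show "q = r" by (simp add: vec_eq_iff forall_2)
  qed
  \<comment> \<open>The double points are \<open>(\<plusminus>u, 0)\<close> with \<open>u = 1 / (2 \<pi> (n + 1))\<close>.\<close>
  moreover have "\<not> inj_on E2.f U" if U: "open U" "0 \<in> U" for U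
  proof
    assume inj: "inj_on E2.f U"
    obtain d where d: "d > 0" "ball 0 d \<subseteq> U" using U openE by blast
    obtain n where n: "inverse (real (Suc n)) < d" using reals_Archimedean[OF d(1)] by blast
    define u where "u = 1 / (2 * pi * real (Suc n))"
    have "real (Suc n) * 1 \<le> real (Suc n) * (2 * pi)" using pi_gt3 by (intro mult_left_mono) auto
    then have "u \<le> inverse (real (Suc n))"
      unfolding u_def by (simp add: inverse_eq_divide frac_le mult.commute)
    with n have "u < d" by simp
    have "u > 0" by (simp add: u_def)
    have mem: "u *\<^sub>R axis 1 1 \<in> U" "- u *\<^sub>R axis 1 1 \<in> U"
      using d(2) \<open>u < d\<close> \<open>u > 0\<close> by (auto simp: subset_iff dist_norm)
    have "x2 u = x2 (- u)"
      using wiggle_zero_at[of "Suc n"] \<open>u > 0\<close> by (simp add: x2_def u_def)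
    then have "E2.f (u *\<^sub>R axis 1 1) = E2.f (- u *\<^sub>R axis 1 1)"
      by (simp add: translation_surface_def axis_def)
    with inj mem have "u *\<^sub>R axis 1 1 = - u *\<^sub>R (axis 1 1 :: real^2)" by (meson inj_onD)
    then have "(u *\<^sub>R axis 1 1 :: real^2) $ 1 = (- u *\<^sub>R axis 1 1 :: real^2) $ 1" by (rule arg_cong)
    then show False using \<open>u > 0\<close> by (simp add: axis_def)
  qed
  ultimately have "\<not> A_equivalent_at euclidean standard_atlas E1.f E2.f 0"
    using A_equivalent_at_preserves_local_injectivity[of euclidean standard_atlas E1.f E2.f 0] by auto
  moreover have "0 \<in> singular_set euclidean standard_atlas E1.f"
    by (simp add: E1.singular_set_f)
  ultimately show ?thesis
    using oriented_surface_plane E1.generic_frontal_f E2.generic_frontal_f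
      \<open>isometric standard_atlas E1.f E2.f\<close> by blast
qed

end
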